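(* Let $n\ge1$ and $0\le k\le n$. For $z_1,\dots,z_k\in\mathbb{C}$ let $u_{k,n}(z_1,\dots,z_k)=(e_{s-r}(z_1,\dots,z_k))_{1\le r,s\le n}\in\mathrm{GL}_n(\mathbb{C})$, where $e_j$ is the $j$th elementary symmetric polynomial for $j\ge0$ and $e_j=0$ for $j<0$. Let $$\mathcal{Y}_{k,n}=\{I_n\}\cup\{u_{k,n}(z_1,\dots,z_k): z_1,\dots,z_k\in\mathbb{C}^\times\text{ distinct},\ z_1^n=\cdots=z_k^n\},$$ and let $q:\mathcal{Y}_{k,n}\to\mathbb{C}$ be given by $q(I_n)=0$ and $q(u_{k,n}(z_1,\dots,z_k))=(-1)^{k-1}z_1^n$. Define $\gamma:\mathcal{Y}_{k,n}\to\mathrm{Gr}_{k,n}(\mathbb{C})$ by requiring $\Delta_I(\gamma(g))=\det(g_{I^c,\{k+1,\dots,n\}})$ (up to a common nonzero scalar) for all $k$-subsets $I\subseteq\{1,\dots,n\}$, where $I^c$ is the complement of $I$ and $g_{R,C}$ is the submatrix of $g$ with rows $R$ and columns $C$. Then for any distinct $z_1,\dots,z_k\in\mathbb{C}^\times$ with $z_1^n=\cdots=z_k^n$, $$\gamma(u_{k,n}(z_1,\dots,z_k))=\mathrm{span}\{(1,z_j,z_j^2,\dots,z_j^{n-1}):1\le j\le k\}.$$ Consequently, for every $t\in\mathbb{C}^\times$, $\gamma$ maps the fiber $q^{-1}(t)$ bijectively onto the set of fixed points in $\mathrm{Gr}_{k,n}(\mathbb{C})$ of the map $\sigma_t\in\mathrm{GL}_n(\mathbb{C})$,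 $\sigma_t(v_1,\dots,v_n)=(v_2,\dots,v_n,(-1)^{k-1}t\,v_1)$.
   Context: $\mathrm{Gr}_{k,n}(\mathbb{C})$ is the set of $k$-dimensional subspaces of $\mathbb{C}^n$; for $V$ the row span of a $k\times n$ matrix $A$, the Plücker coordinate $\Delta_I(V)$ is the $k\times k$ minor of $A$ in columns $I$, and these projective coordinates determine $V$. $\sigma_t$ acts on $\mathrm{Gr}_{k,n}(\mathbb{C})$ by $V\mapsto\{\sigma_t(v):v\in V\}$.
   Formalization: For k=0 (no z_1) and k=n (every u_{n,n}(z)=I_n, so q(I_n) would be both 0 and nonzero) q is not a function; there the bijection is stated for the g to which the clauses for q assign the value t (any common value allowed if k=0). For 0<k<n, q is the function as given. *)

theory Defs
  imports Complex_Main "Jordan_Normal_Form.DL_Rank_Submatrix"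
begin

text \<open>Points \<open>z\<^sub>1, \<dots>, z\<^sub>k\<close> are a function \<open>z\<close> of which only the values on \<open>{1..k}\<close> matter.
  Rows and columns of matrices, entries of vectors and hence the subsets \<open>I\<close> are numbered
  from \<open>0\<close> to \<open>n - 1\<close>; in particular the columns \<open>k+1, \<dots>, n\<close> become \<open>{k..<n}\<close>.\<close>

definition esym :: "nat \<Rightarrow> (nat \<Rightarrow> complex) \<Rightarrow> nat \<Rightarrow> complex" where
  "esym k z j = (\<Sum>S | S \<subseteq> {1..k} \<and> card S = j. \<Prod>i\<in>S. z i)"

definition GL :: "nat \<Rightarrow> complex mat set" where
  "GL n = {g \<in> carrier_mat n n. invertible_mat g}"

definition umat :: "nat \<Rightarrow> nat \<Rightarrow> (nat \<Rightarrow> complex) \<Rightarrow> complex mat" where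
  "umat k n z = mat n n (\<lambda>(r, s). if r \<le> s then esym k z (s - r) else 0)"

definition admissible :: "nat \<Rightarrow> nat \<Rightarrow> (nat \<Rightarrow> complex) \<Rightarrow> bool" where
  "admissible k n z \<longleftrightarrow> inj_on z {1..k} \<and> (\<forall>j\<in>{1..k}. z j \<noteq> 0) \<and>
     (\<forall>i\<in>{1..k}. \<forall>j\<in>{1..k}. z i ^ n = z j ^ n)"

definition Y :: "nat \<Rightarrow> nat \<Rightarrow> complex mat set" where
  "Y k n = {1\<^sub>m n} \<union> {umat k n z | z. admissible k n z}"

text \<open>The two clauses prescribing the value of \<open>q\<close>, as a relation; \<open>c\<close> is the common value
  \<open>z\<^sub>1\<^sup>n = \<dots> = z\<^sub>k\<^sup>n\<close>. For \<open>0 < k < n\<close> the relation is the graph of a function on \<open>Y k n\<close>. In the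
  degenerate cases \<open>k = 0\<close> (where \<open>z\<^sub>1\<close> does not exist, so \<open>c\<close> is unconstrained) and \<open>k = n\<close>
  every \<open>umat k n z\<close> is the identity matrix, and the clauses give it several values.\<close>

definition q_graph :: "nat \<Rightarrow> nat \<Rightarrow> complex mat \<Rightarrow> complex \<Rightarrow> bool" where
  "q_graph k n g w \<longleftrightarrow> (g = 1\<^sub>m n \<and> w = 0) \<or>
     (\<exists>z c. admissible k n z \<and> g = umat k n z \<and> (\<forall>j\<in>{1..k}. z j ^ n = c) \<and>
        w = (-1) powi (int k - 1) * c)"

definition q :: "nat \<Rightarrow> nat \<Rightarrow> complex mat \<Rightarrow> complex" where
  "q k n g = (THE w. q_graph k n g w)"

abbreviation Cn :: "nat \<Rightarrow> (complex, complex vec) module" where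
  "Cn n \<equiv> module_vec TYPE(complex) n"

abbreviation span_Cn :: "nat \<Rightarrow> complex vec set \<Rightarrow> complex vec set" where
  "span_Cn n \<equiv> LinearCombinations.module.span class_ring (Cn n)"

definition Gr :: "nat \<Rightarrow> nat \<Rightarrow> complex vec set set" where
  "Gr k n = {V. VectorSpace.subspace class_ring V (Cn n) \<and>
     vectorspace.dim class_ring ((Cn n)\<lparr>carrier := V\<rparr>) = k}"

definition plucker :: "complex mat \<Rightarrow> nat set \<Rightarrow> complex" where
  "plucker A I = det (submatrix A UNIV I)"

definition gamma_rel :: "nat \<Rightarrow> nat \<Rightarrow> complex mat \<Rightarrow> complex vec set \<Rightarrow> bool" where
  "gamma_rel k n g V \<longleftrightarrow> V \<in> Gr k n \<and>
     (\<exists>A \<in> carrier_mat k n. span_Cn n (set (rows A)) = V \<and>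
       (\<exists>c. c \<noteq> 0 \<and> (\<forall>I. I \<subseteq> {0..<n} \<and> card I = k \<longrightarrow>
          plucker A I = c * det (submatrix g ({0..<n} - I) {k..<n}))))"

definition gamma :: "nat \<Rightarrow> nat \<Rightarrow> complex mat \<Rightarrow> complex vec set" where
  "gamma k n g = (THE V. gamma_rel k n g V)"

definition sigma :: "nat \<Rightarrow> nat \<Rightarrow> complex \<Rightarrow> complex vec \<Rightarrow> complex vec" where
  "sigma k n t v =
     vec n (\<lambda>i. if i + 1 < n then v $ (i + 1) else (-1) powi (int k - 1) * t * v $ 0)"

definition sigma_fixed :: "nat \<Rightarrow> nat \<Rightarrow> complex \<Rightarrow> complex vec set set" where
  "sigma_fixed k n t = {V \<in> Gr k n. sigma k n t ` V = V}"

end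

theory Submission
  imports Defs "HOL-Computational_Algebra.Polynomial"
begin

text \<open>Column \<open>s \<ge> k\<close> of \<open>umat k n z\<close>, with alternating signs, consists of the coefficients of a
  multiple of \<open>\<Prod>(x - z\<^sub>i)\<close>, so these columns span the kernel of the Vandermonde matrix with
  rows \<open>(1, z\<^sub>j, \<dots>, z\<^sub>j\<^bsup>n-1\<^esup>)\<close>. The maximal minors of a matrix are, up to sign and a common factor,
  the complementary minors of a basis of its kernel; hence \<open>\<gamma>\<close> sends \<open>umat k n z\<close> to the row span
  of the Vandermonde matrix. The vectors \<open>(1, x, \<dots>, x\<^bsup>n-1\<^esup>)\<close> with \<open>x\<^sup>n = (-1)\<^bsup>k-1\<^esup>t\<close> are eigenvectors of
  \<open>\<sigma>\<^sub>t\<close> for \<open>n\<close> distinct eigenvalues \<open>x\<close>, so the invariant subspaces are the spans of subsets of them.\<close>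

section \<open>Complementary minors\<close>

text \<open>Every matrix in \<open>Y k n\<close> is upper unitriangular, so its complementary minor
  for the leading set \<open>{0..<k}\<close> is 1, and all values of \<open>gamma\<close> lie in the
  one affine chart where the leading coordinate is nonzero. The delicate point is the sign: sorting
  I in front of its complement costs (-1) to the difference of the index sums of I and of the
  leading set, which is just what an alternating sign on the columns produces. Both
  \<open>umat k n z\<close> and its image depend only on the set of the points z, so the fiber over
  t and the fixed subspaces are both parametrized by the k-subsets of the n roots of x^n =
  (-1)^(k-1) t.\<close>

lemma transpose_Suc_less:
  assumes "x < y" "\<not> (x = m \<and> y = Suc m)"
  shows "Transposition.transpose m (Suc m) x < Transposition.transpose m (Suc m) y"
  using assms by (auto simp: Transposition.transpose_def)

text \<open>A map increasing on both blocks can differ from the identity only through a descent from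
  \<open>p (k - 1)\<close> to \<open>p k\<close>. The least value above \<open>p k\<close> in the
  first block then has its predecessor in the second block: by minimality, or because the
  predecessor is \<open>p k\<close> itself.\<close>

lemma sorted_shuffle_id_or_adjacent_inversion:
  assumes p: "p permutes {0..<n}" and kn: "k \<le> n"
    and m1: "strict_mono_on {0..<k} p" and m2: "strict_mono_on {k..<n} p"
  shows "p = id \<or> (\<exists>a<k. \<exists>b\<in>{k..<n}. p a = Suc (p b))"
proof (cases "0 < k \<and> k < n \<and> p k < p (k - 1)")
  case True
  let ?P = "\<lambda>v. v \<in> p ` {0..<k} \<and> p k < v"
  define v where "v = (LEAST v. ?P v)"
  have "?P (p (k - 1))" using True by auto
  then have v: "?P v" unfolding v_def by (rule LeastI)
  have vmin: "v \<le> w" if "?P w" for w unfolding v_def using that by (rule Least_le)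
  from v obtain a where a: "a < k" "p a = v" by auto
  have notin: "v - 1 \<notin> p ` {0..<k}"
  proof
    assume *: "v - 1 \<in> p ` {0..<k}"
    show False
    proof (cases "p k < v - 1")
      case True
      then show False using vmin[of "v - 1"] * by auto
    next
      case False
      then have "p k = v - 1" using v by auto
      then obtain c where "c < k" "p c = p k" using * by auto
      then show False using permutes_inj[OF p] by (auto dest: injD)
    qed
  qed
  have "v - 1 \<in> p ` {0..<n}"
  proof -
    have "v < n" using a kn permutes_in_image[OF p, of a] by auto
    then show ?thesis unfolding permutes_image[OF p] by auto
  qed
  then obtain b where b: "b \<in> {0..<n}" "v - 1 = p b" by (rule imageE)
  have "\<not> b < k" using notin b(2) by auto
  then have b: "b \<in> {k..<n}" "p b = v - 1" using b by auto
  then have "p a = Suc (p b)" using v a by auto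
  then show ?thesis using a(1) b(1) by (intro disjI2 exI[of _ a] conjI bexI[of _ b])
next
  case False
  \<comment> \<open>Without a descent at the boundary the two increasing runs join to one, and an
    increasing permutation satisfies \<open>i <= p i\<close>, hence is the identity.\<close>
  have mono: "p i < p j" if "i < j" "j < n" for i j
  proof -
    consider "j < k" | "k \<le> i" | "i < k" "k \<le> j" using \<open>i < j\<close> by linarith
    then show ?thesis
    proof cases
      case 1 then show ?thesis using m1 that by (auto simp: strict_mono_on_def)
    next
      case 2 then show ?thesis using m2 that by (auto simp: strict_mono_on_def)
    next
      case 3
      have kn: "0 < k" "k < n" using 3 that by auto
      have "p (k - 1) \<noteq> p k" using permutes_inj[OF p] kn by (auto dest!: injD)
      then have "p (k - 1) < p k" using False kn by auto
      moreover have "p i \<le> p (k - 1)"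
        using m1 3 by (cases "i = k - 1") (auto simp: strict_mono_on_def less_imp_le)
      moreover have "p k \<le> p j"
        using m2 3 that by (cases "j = k") (auto simp: strict_mono_on_def less_imp_le)
      ultimately show ?thesis by linarith
    qed
  qed
  have "i < n \<Longrightarrow> i \<le> p i" for i
  proof (induction i)
    case (Suc i)
    then show ?case using mono[of i "Suc i"] by simp
  qed simp
  then show ?thesis using permutes_natset_ge[OF p] by auto
qed

text \<open>Exchanging adjacent values that lie in different blocks in the wrong order gives a
  shuffle again, flips the sign and lowers the sum over the first block by one. Induction on that
  sum ends at the identity.\<close>

lemma sign_sorted_shuffle:
  assumes "p permutes {0..<n}" "k \<le> n"
    and "strict_mono_on {0..<k} p" "strict_mono_on {k..<n} p"
  shows "sign p * (-1) ^ (\<Sum>b<k. p b) = (-1) ^ (\<Sum>b<k. b)"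
  using assms
proof (induction "\<Sum>b<k. p b" arbitrary: p rule: less_induct)
  case less
  note p = less.prems(1) and kn = less.prems(2) and m1 = less.prems(3) and m2 = less.prems(4)
  consider "p = id" | a b where "a < k" "b \<in> {k..<n}" "p a = Suc (p b)"
    using sorted_shuffle_id_or_adjacent_inversion[OF p kn m1 m2] by blast
  then show ?case
  proof cases
    case 2
    let ?t = "Transposition.transpose (p b) (Suc (p b))"
    let ?q = "?t \<circ> p"
    have inj: "p i = p j \<Longrightarrow> i = j" for i j using permutes_inj[OF p] by (auto dest: injD)
    have t: "?t permutes {0..<n}"
      using 2 permutes_in_image[OF p, of a] permutes_in_image[OF p, of b] kn
      by (intro permutes_swap_id) auto
    have q: "?q permutes {0..<n}" using permutes_compose[OF p t] .
    have q1: "strict_mono_on {0..<k} ?q"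
      unfolding strict_mono_on_def
    proof (intro allI impI)
      fix r s assume rs: "r \<in> {0..<k} \<and> s \<in> {0..<k} \<and> r < s"
      then have "p r < p s" using m1 by (auto simp: strict_mono_on_def)
      moreover have "p r \<noteq> p b" using inj[of r b] rs 2 by auto
      ultimately show "?q r < ?q s" unfolding o_def by (intro transpose_Suc_less) auto
    qed
    have q2: "strict_mono_on {k..<n} ?q"
      unfolding strict_mono_on_def
    proof (intro allI impI)
      fix r s assume rs: "r \<in> {k..<n} \<and> s \<in> {k..<n} \<and> r < s"
      then have "p r < p s" using m2 by (auto simp: strict_mono_on_def)
      moreover have "p s \<noteq> Suc (p b)" using inj[of s a] rs 2 by auto
      ultimately show "?q r < ?q s" unfolding o_def by (intro transpose_Suc_less) auto
    qed
    have other: "?q c = p c" if "c < k" "c \<noteq> a" for c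
      using inj[of c a] inj[of c b] that 2 by (auto simp: Transposition.transpose_def)
    have qa: "?q a = p b" using 2 by (simp add: Transposition.transpose_def)
    have split: "(\<Sum>c<k. f c) = f a + (\<Sum>c\<in>{..<k} - {a}. f c)" for f :: "nat \<Rightarrow> nat"
      using 2 by (intro sum.remove) auto
    have "(\<Sum>c\<in>{..<k} - {a}. ?q c) = (\<Sum>c\<in>{..<k} - {a}. p c)"
      using other by (intro sum.cong) auto
    then have sums: "(\<Sum>c<k. p c) = Suc (\<Sum>c<k. ?q c)"
      unfolding split[of p] split[of ?q] using qa 2 by simp
    have "sign ?q = - sign p"
      using p t by (subst sign_compose)
        (auto simp: permutes_imp_permutation[OF _ p] permutation_swap_id sign_swap_id)
    moreover have "sign ?q * (-1) ^ (\<Sum>c<k. ?q c) = (-1) ^ (\<Sum>b<k. b)"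
      using sums by (intro less.hyps q q1 q2 kn) simp
    ultimately show ?thesis using sums by simp
  qed simp
qed

text \<open>Compute det (M * N) twice. M is A completed by unit rows; N has unit columns that select
  the columns \<open>p j\<close> of A, followed by the columns of G. By orthogonality the product is
  block lower triangular with diagonal blocks \<open>?Ap\<close> and \<open>?G\<close>, while det M
  is the leading minor of A and det N is, up to sign, the minor of G in the remaining rows.\<close>

lemma complementary_minors:
  fixes A G :: "'a :: idom mat"
  assumes p: "p permutes {0..<n}" and kn: "k \<le> n"
    and orth: "\<And>a s. a < k \<Longrightarrow> k \<le> s \<Longrightarrow> s < n \<Longrightarrow> (\<Sum>i<n. A $$ (a, i) * G $$ (i, s)) = 0"
  shows "det (mat k k (\<lambda>(i, j). A $$ (i, p j))) *
      det (mat (n - k) (n - k) (\<lambda>(i, j). G $$ (k + i, k + j))) =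
    signof p * det (mat k k (\<lambda>(i, j). A $$ (i, j))) *
      det (mat (n - k) (n - k) (\<lambda>(i, j). G $$ (p (k + i), k + j)))"
    (is "det ?Ap * det ?G = _ * det ?A * det ?Gp")
proof -
  define m where "m = n - k"
  have n: "n = k + m" using kn by (simp add: m_def)
  define M where "M = mat n n (\<lambda>(i, j). if i < k then A $$ (i, j) else if i = j then 1 else 0)"
  define N where "N = mat n n (\<lambda>(i, j). if j < k then if i = p j then 1 else 0 else G $$ (i, j))"
  have M: "M \<in> carrier_mat n n" and N: "N \<in> carrier_mat n n" by (auto simp: M_def N_def)
  have pn: "p i < n \<longleftrightarrow> i < n" for i using permutes_in_image[OF p, of i] by auto
  have pinj: "p i = p j \<longleftrightarrow> i = j" for i j using permutes_inj[OF p] by (auto dest: injD)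
  have "M = four_block_mat ?A (mat k m (\<lambda>(i, j). A $$ (i, k + j))) (0\<^sub>m m k) (1\<^sub>m m)"
    by (rule eq_matI) (auto simp: M_def n)
  then have detM: "det M = det ?A"
    using det_four_block_mat_lower_left_zero[of ?A k "mat k m (\<lambda>(i, j). A $$ (i, k + j))" m
        "0\<^sub>m m k" "1\<^sub>m m"] by simp
  have MN_top: "(M * N) $$ (i, j) = (if j < k then A $$ (i, p j) else 0)" if "i < k" "j < n" for i j
  proof -
    have "(M * N) $$ (i, j) = (\<Sum>l<n. A $$ (i, l) * N $$ (l, j))"
      using that kn by (auto simp: M_def N_def scalar_prod_def atLeast0LessThan intro!: sum.cong)
    also have "\<dots> = (if j < k then A $$ (i, p j) else 0)"
    proof (cases "j < k")
      case True
      then have "(\<Sum>l<n. A $$ (i, l) * N $$ (l, j)) = (\<Sum>l<n. if l = p j then A $$ (i, l) else 0)"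
        using kn by (intro sum.cong) (auto simp: N_def)
      then show ?thesis using True kn pn[of j] by simp
    next
      case False
      then have "(\<Sum>l<n. A $$ (i, l) * N $$ (l, j)) = (\<Sum>l<n. A $$ (i, l) * G $$ (l, j))"
        using that by (intro sum.cong) (auto simp: N_def)
      then show ?thesis using False orth[of i j] that by simp
    qed
    finally show ?thesis .
  qed
  have MN_bot: "(M * N) $$ (i, j) = N $$ (i, j)" if "k \<le> i" "i < n" "j < n" for i j
  proof -
    have "(M * N) $$ (i, j) = (\<Sum>l<n. M $$ (i, l) * N $$ (l, j))"
      using that M N by (auto simp: scalar_prod_def atLeast0LessThan intro!: sum.cong)
    also have "\<dots> = (\<Sum>l<n. if l = i then N $$ (l, j) else 0)"
      using that by (intro sum.cong) (auto simp: M_def)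
    finally have "(M * N) $$ (i, j) = (\<Sum>l<n. if l = i then N $$ (l, j) else 0)" .
    then show ?thesis using that by simp
  qed
  have MN: "M * N = four_block_mat ?Ap (0\<^sub>m k m) (mat m k (\<lambda>(i, j). N $$ (k + i, j))) ?G"
    (is "_ = ?R")
  proof (rule eq_matI)
    fix i j assume "i < dim_row ?R" "j < dim_col ?R"
    then have ij: "i < n" "j < n" using n by auto
    show "(M * N) $$ (i, j) = ?R $$ (i, j)"
    proof (cases "i < k")
      case True
      then show ?thesis using MN_top[OF True ij(2)] ij n by auto
    next
      case False
      then have "(M * N) $$ (i, j) = N $$ (i, j)" using MN_bot ij by simp
      then show ?thesis using False ij n by (auto simp: N_def)
    qed
  qed (simp_all add: n M_def N_def)
  have "det M * det N = det ?Ap * det ?G"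
    unfolding det_mult[OF M N, symmetric] MN
    by (rule det_four_block_mat_upper_right_zero) (auto simp: m_def)
  moreover have "det ?Gp = signof p * det N"
  proof -
    have "mat n n (\<lambda>(i, j). N $$ (p i, j)) =
        four_block_mat (1\<^sub>m k) (mat k m (\<lambda>(i, j). G $$ (p i, k + j))) (0\<^sub>m m k) ?Gp"
      by (rule eq_matI) (use kn in \<open>auto simp: N_def pinj pn m_def\<close>)
    then have "det (mat n n (\<lambda>(i, j). N $$ (p i, j))) = det ?Gp"
      using det_four_block_mat_lower_left_zero[of "1\<^sub>m k" k
          "mat k m (\<lambda>(i, j). G $$ (p i, k + j))" m "0\<^sub>m m k" ?Gp] by (simp add: m_def)
    then show ?thesis using det_permute_rows[OF N p] by simp
  qed
  moreover have "signof p * signof p = (1 :: 'a)"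
    by (simp add: sign_def)
  ultimately show ?thesis unfolding detM[symmetric] by (simp add: mult_ac)
qed

lemma det_permute_cols:
  assumes A: "A \<in> carrier_mat n n" and p: "p permutes {0..<n}"
  shows "det (mat n n (\<lambda>(i, j). A $$ (i, p j))) = signof p * det A"
proof -
  have pn: "p i < n \<longleftrightarrow> i < n" for i using permutes_in_image[OF p, of i] by auto
  have "mat n n (\<lambda>(i, j). A $$ (i, p j)) = (mat n n (\<lambda>(i, j). transpose_mat A $$ (p i, j)))\<^sup>T"
    using A pn by (intro eq_matI) auto
  then show ?thesis
    using det_permute_rows[of "transpose_mat A" n p] A p
      det_transpose[of "mat n n (\<lambda>(i, j). transpose_mat A $$ (p i, j))" n]
    by (simp add: det_transpose[OF A])
qed

section \<open>Index sets, their enumeration by \<open>pick\<close>, and the attached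
  shuffles\<close>

lemma submatrix_eq_mat_pick:
  assumes "A \<in> carrier_mat r n" "R \<subseteq> {0..<r}" "C \<subseteq> {0..<n}"
  shows "submatrix A R C = mat (card R) (card C) (\<lambda>(i, j). A $$ (pick R i, pick C j))"
proof -
  have "{i. i < r \<and> i \<in> R} = R" "{j. j < n \<and> j \<in> C} = C" using assms by auto
  then show ?thesis using assms by (simp add: submatrix_def)
qed

lemma plucker_eq_det:
  assumes "A \<in> carrier_mat k n" "I \<subseteq> {0..<n}" "card I = k"
  shows "plucker A I = det (mat k k (\<lambda>(i, j). A $$ (i, pick I j)))"
proof -
  have "{j. j < n \<and> j \<in> I} = I" using assms by auto
  then show ?thesis using assms by (simp add: plucker_def submatrix_def pick_UNIV)
qed

lemma pick_atLeastLessThan: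
  assumes "i < n - k"
  shows "pick {k..<n} i = k + i"
proof -
  have "{a \<in> {k..<n}. a < k + i} = {k..<k + i}" using assms by auto
  then show ?thesis using pick_card_in_set[of "k + i" "{k..<n}"] assms by simp
qed

text \<open>Listing I and then its complement, each in increasing order, is a shuffle; this turns
  minors with columns I into minors with columns \<open>p j\<close>, to which the sign count
  applies.\<close>

lemma pick_permutation:
  assumes I: "I \<subseteq> {0..<n}" and k: "card I = k"
  obtains p where "p permutes {0..<n}" "strict_mono_on {0..<k} p" "strict_mono_on {k..<n} p"
    "\<And>i. i < k \<Longrightarrow> p i = pick I i" "\<And>i. i < n - k \<Longrightarrow> p (k + i) = pick ({0..<n} - I) i"
proof -
  let ?J = "{0..<n} - I"
  define p where "p i = (if i < k then pick I i else if i < n then pick ?J (i - k) else i)" for i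
  have cJ: "card ?J = n - k" using I k by (simp add: card_Diff_subset finite_subset)
  have inI: "i < k \<Longrightarrow> pick I i \<in> I" for i using pick_in_set[of i I] k by simp
  have inJ: "i < n - k \<Longrightarrow> pick ?J i \<in> ?J" for i using pick_in_set[of i ?J] cJ by simp
  have kn: "k \<le> n" using card_mono[OF _ I] k by simp
  have m1: "strict_mono_on {0..<k} p"
    unfolding strict_mono_on_def using k by (auto simp: p_def intro!: pick_mono)
  have m2: "strict_mono_on {k..<n} p"
    unfolding strict_mono_on_def using cJ by (auto simp: p_def intro!: pick_mono)
  have 1: "p i \<in> I" if "i < k" for i using that inI by (simp add: p_def)
  have 2: "p i \<in> ?J" if "i \<in> {k..<n}" for i using that inJ[of "i - k"] diff_less_mono[of i n k] by (simp add: p_def)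
  have "inj_on p ({0..<k} \<union> {k..<n})"
    using strict_mono_on_imp_inj_on[OF m1] strict_mono_on_imp_inj_on[OF m2] 1 2
    by (subst inj_on_Un) fastforce
  moreover have "{0..<k} \<union> {k..<n} = {0..<n}" using kn by auto
  moreover have "p \<in> {0..<n} \<rightarrow> {0..<n}"
  proof
    fix i assume "i \<in> {0..<n}"
    then show "p i \<in> {0..<n}" using 1[of i] 2[of i] I by (cases "i < k") auto
  qed
  ultimately have "p permutes {0..<n}"
    using kn by (intro inj_on_nat_permutes) (auto simp: p_def)
  then show thesis
    by (rule that) (use m1 m2 kn in \<open>auto simp: p_def\<close>)
qed

lemma det_diagonal:
  fixes d :: "nat \<Rightarrow> 'a :: comm_ring_1"
  shows "det (mat k k (\<lambda>(i, j). if i = j then d i else 0)) = (\<Prod>i<k. d i)"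
proof -
  have "det (mat k k (\<lambda>(i, j). if i = j then d i else 0)) =
      prod_list (diag_mat (mat k k (\<lambda>(i, j). if i = j then d i else 0)))"
    by (rule det_upper_triangular) auto
  also have "\<dots> = prod_list (map d [0..<k])"
    unfolding diag_mat_def by (intro arg_cong[where f = prod_list] map_cong) auto
  also have "\<dots> = (\<Prod>i<k. d i)"
    by (simp add: prod.distinct_set_conv_list[symmetric] atLeast0LessThan)
  finally show ?thesis .
qed

lemma det_scale_cols:
  fixes A :: "'a :: comm_ring_1 mat"
  shows "det (mat k k (\<lambda>(i, j). d j * f i j)) = (\<Prod>j<k. d j) * det (mat k k (\<lambda>(i, j). f i j))"
    (is "det ?L = _ * det ?A")
proof -
  let ?D = "mat k k (\<lambda>(i, j). if i = j then d i else 0)"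
  have "?L = ?A * ?D"
  proof (rule eq_matI)
    fix i j assume "i < dim_row (?A * ?D)" "j < dim_col (?A * ?D)"
    then have ij: "i < k" "j < k" by auto
    then have "(?A * ?D) $$ (i, j) = (\<Sum>l\<in>{0..<k}. f i l * (if l = j then d l else 0))"
      by (auto simp: scalar_prod_def intro!: sum.cong)
    also have "\<dots> = (\<Sum>l\<in>{0..<k}. if l = j then f i l * d l else 0)"
      by (intro sum.cong) auto
    finally show "?L $$ (i, j) = (?A * ?D) $$ (i, j)" using ij by (simp add: mult.commute)
  qed auto
  then show ?thesis by (simp add: det_mult[of _ k] det_diagonal mult.commute)
qed

text \<open>The alternating signs in the orthogonality assumption cancel the signs of the
  permutations that sort \<open>I\<close> to the front.\<close>

lemma plucker_complementary_minor:
  fixes A g :: "complex mat"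
  assumes A: "A \<in> carrier_mat k n" and g: "g \<in> carrier_mat n n"
    and orth: "\<And>a s. a < k \<Longrightarrow> k \<le> s \<Longrightarrow> s < n \<Longrightarrow>
      (\<Sum>i<n. (-1) ^ i * A $$ (a, i) * g $$ (i, s)) = 0"
    and I: "I \<subseteq> {0..<n}" "card I = k"
  shows "plucker A I * det (submatrix g {k..<n} {k..<n}) =
    plucker A {0..<k} * det (submatrix g ({0..<n} - I) {k..<n})"
proof -
  have kn: "k \<le> n" using card_mono[OF _ I(1)] I(2) by simp
  obtain p where p: "p permutes {0..<n}" "strict_mono_on {0..<k} p" "strict_mono_on {k..<n} p"
    and pI: "\<And>i. i < k \<Longrightarrow> p i = pick I i"
    and pJ: "\<And>i. i < n - k \<Longrightarrow> p (k + i) = pick ({0..<n} - I) i"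
    using pick_permutation[OF I] by blast
  let ?B = "mat k n (\<lambda>(a, i). (-1) ^ i * A $$ (a, i))"
  have pn: "p i < n \<longleftrightarrow> i < n" for i using permutes_in_image[OF p(1), of i] by auto
  have pIn: "pick I i < n" if "i < k" for i using pn[of i] pI[OF that] that kn by simp
  have cJ: "card ({0..<n} - I) = n - k" using I by (simp add: card_Diff_subset finite_subset)
  have main: "det (mat k k (\<lambda>(i, j). ?B $$ (i, p j))) *
      det (mat (n - k) (n - k) (\<lambda>(i, j). g $$ (k + i, k + j))) =
    signof p * det (mat k k (\<lambda>(i, j). ?B $$ (i, j))) *
      det (mat (n - k) (n - k) (\<lambda>(i, j). g $$ (p (k + i), k + j)))"
    using orth by (intro complementary_minors p kn) simp
  have Ap: "det (mat k k (\<lambda>(i, j). ?B $$ (i, p j))) = (-1) ^ (\<Sum>b<k. p b) * plucker A I"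
  proof -
    have "mat k k (\<lambda>(i, j). ?B $$ (i, p j)) = mat k k (\<lambda>(i, j). (-1) ^ p j * A $$ (i, pick I j))"
      using kn pIn pI by (intro eq_matI) auto
    then show ?thesis
      by (simp add: det_scale_cols plucker_eq_det[OF A I] power_sum)
  qed
  have A1: "det (mat k k (\<lambda>(i, j). ?B $$ (i, j))) = (-1) ^ (\<Sum>b<k. b) * plucker A {0..<k}"
  proof -
    have "mat k k (\<lambda>(i, j). ?B $$ (i, j)) = mat k k (\<lambda>(i, j). (-1) ^ j * A $$ (i, pick {0..<k} j))"
      using kn pick_atLeastLessThan[of _ k 0] by (intro eq_matI) auto
    then show ?thesis
      using kn by (simp add: det_scale_cols plucker_eq_det[OF A] power_sum)
  qed
  have G1: "mat (n - k) (n - k) (\<lambda>(i, j). g $$ (k + i, k + j)) = submatrix g {k..<n} {k..<n}"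
    by (subst submatrix_eq_mat_pick[OF g]) (auto intro!: eq_matI simp: pick_atLeastLessThan)
  have Gp: "mat (n - k) (n - k) (\<lambda>(i, j). g $$ (p (k + i), k + j)) =
      submatrix g ({0..<n} - I) {k..<n}"
    by (subst submatrix_eq_mat_pick[OF g]) (auto intro!: eq_matI simp: pick_atLeastLessThan pJ cJ)
  have sg: "signof p * (-1) ^ (\<Sum>b<k. b) = ((-1) ^ (\<Sum>b<k. p b) :: complex)"
  proof -
    have "of_int (sign p * (-1) ^ (\<Sum>b<k. p b)) = (of_int ((-1) ^ (\<Sum>b<k. b)) :: complex)"
      using sign_sorted_shuffle[OF p(1) kn p(2,3)] by simp
    then have "signof p * (-1) ^ (\<Sum>b<k. p b) = ((-1) ^ (\<Sum>b<k. b) :: complex)" by simp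
    then show ?thesis by (cases "evenperm p") (auto simp: sign_def dest: sym)
  qed
  have "(-1) ^ (\<Sum>b<k. p b) * (plucker A I * det (submatrix g {k..<n} {k..<n})) =
      signof p * ((-1) ^ (\<Sum>b<k. b) * plucker A {0..<k}) *
        det (submatrix g ({0..<n} - I) {k..<n})"
    using main unfolding Ap A1 G1 Gp by (simp only: mult.assoc)
  also have "\<dots> = (signof p * (-1) ^ (\<Sum>b<k. b)) *
      (plucker A {0..<k} * det (submatrix g ({0..<n} - I) {k..<n}))"
    by (simp only: mult.assoc)
  finally have "(-1) ^ (\<Sum>b<k. p b) * (plucker A I * det (submatrix g {k..<n} {k..<n})) =
      (-1) ^ (\<Sum>b<k. p b) * (plucker A {0..<k} * det (submatrix g ({0..<n} - I) {k..<n}))"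
    unfolding sg .
  then show ?thesis by simp
qed

section \<open>Row spans and Pluecker coordinates\<close>

abbreviation row_span :: "nat \<Rightarrow> complex mat \<Rightarrow> complex vec set" where
  "row_span n A \<equiv> span_Cn n (set (rows A))"

lemma row_span_eq:
  assumes A: "A \<in> carrier_mat k n"
  shows "row_span n A = {vec n (\<lambda>i. \<Sum>a<k. c a * A $$ (a, i)) | c. True}"
proof -
  interpret vec_space "TYPE(complex)" n .
  have rs: "row_span n A = {w \<in> carrier_vec n. \<exists>y\<in>carrier_vec k. A\<^sup>T *\<^sub>v y = w}"
    using row_space_eq[OF A] A by (simp add: row_space_def)
  have mult: "A\<^sup>T *\<^sub>v y = vec n (\<lambda>i. \<Sum>a<k. y $ a * A $$ (a, i))" if "y \<in> carrier_vec k" for y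
    using A that by (intro eq_vecI)
      (auto simp: scalar_prod_def atLeast0LessThan mult.commute intro!: sum.cong)
  show ?thesis unfolding rs
  proof (intro equalityI subsetI)
    fix w assume "w \<in> {w \<in> carrier_vec n. \<exists>y\<in>carrier_vec k. A\<^sup>T *\<^sub>v y = w}"
    then obtain y where "y \<in> carrier_vec k" "w = A\<^sup>T *\<^sub>v y" by auto
    then show "w \<in> {vec n (\<lambda>i. \<Sum>a<k. c a * A $$ (a, i)) | c. True}" using mult by auto
  next
    fix w assume "w \<in> {vec n (\<lambda>i. \<Sum>a<k. c a * A $$ (a, i)) | c. True}"
    then obtain c where w: "w = vec n (\<lambda>i. \<Sum>a<k. c a * A $$ (a, i))" by auto
    have "w = A\<^sup>T *\<^sub>v vec k c" unfolding w by (subst mult) (auto intro!: eq_vecI sum.cong)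
    moreover have "w \<in> carrier_vec n" using w by simp
    ultimately show "w \<in> {w \<in> carrier_vec n. \<exists>y\<in>carrier_vec k. A\<^sup>T *\<^sub>v y = w}"
      by (auto intro!: bexI[of _ "vec k c"])
  qed
qed

lemma det_nonzero_inverse:
  fixes A :: "'a :: field mat"
  assumes "A \<in> carrier_mat n n" "det A \<noteq> 0"
  obtains B where "B \<in> carrier_mat n n" "A * B = 1\<^sub>m n" "B * A = 1\<^sub>m n"
  using det_non_zero_imp_unit[OF assms, where b = "()"] unfolding Units_def ring_mat_def by auto

lemma det_nonzero_GL:
  assumes "A \<in> carrier_mat n n" "det A \<noteq> 0"
  shows "A \<in> GL n"
proof -
  obtain B where B: "B \<in> carrier_mat n n" "A * B = 1\<^sub>m n" "B * A = 1\<^sub>m n"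
    using det_nonzero_inverse[OF assms] .
  then have "inverts_mat A B \<and> inverts_mat B A" using assms(1) by (simp add: inverts_mat_def)
  then show ?thesis using assms(1) unfolding GL_def invertible_mat_def square_mat.simps by auto
qed

lemma row_span_mult_invertible:
  assumes P: "P \<in> carrier_mat k k" "det P \<noteq> 0" and A: "A \<in> carrier_mat k n"
  shows "row_span n (P * A) = row_span n A"
proof -
  interpret vec_space "TYPE(complex)" n .
  have "invertible_mat P" using det_nonzero_GL[OF P] by (simp add: GL_def)
  then show ?thesis using row_space_is_preserved[OF _ P(1) A] by (simp add: row_space_def)
qed

text \<open>A kernel vector of the transpose is a linear relation among the rows; restricted to the
  leading k columns it is a kernel vector of an invertible block.\<close>

lemma row_span_in_Gr:
  assumes A: "A \<in> carrier_mat k n" and kn: "k \<le> n" and det: "plucker A {0..<k} \<noteq> 0"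
  shows "row_span n A \<in> Gr k n"
proof -
  interpret vec_space "TYPE(complex)" n .
  let ?A1 = "mat k k (\<lambda>(i, j). A $$ (i, j))"
  have "mat k k (\<lambda>(i, j). A $$ (i, pick {0..<k} j)) = ?A1"
    using pick_atLeastLessThan[of _ k 0] by (intro eq_matI) auto
  then have det1: "det ?A1 \<noteq> 0" using det kn by (simp add: plucker_eq_det[OF A])
  have AT: "A\<^sup>T \<in> carrier_mat n k" using A by simp
  \<comment> \<open>The span is taken of a set of rows, in which equal rows would merge; the nonzero
    minor rules them out.\<close>
  have dist: "distinct (cols (A\<^sup>T))"
    unfolding distinct_conv_nth
  proof (intro allI impI notI)
    fix i j assume ij: "i < length (cols A\<^sup>T)" "j < length (cols A\<^sup>T)" "i \<noteq> j"
      and eq: "cols A\<^sup>T ! i = cols A\<^sup>T ! j"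
    then have lt: "i < k" "j < k" using A by auto
    have "row A i = row A j" using eq lt A by simp
    then have "A $$ (i, l) = A $$ (j, l)" if "l < n" for l
      using that lt A by (metis carrier_matD index_row(1))
    then have "row ?A1 i = row ?A1 j" using lt kn by (intro eq_vecI) auto
    then show False using det_identical_rows[of ?A1 k i j] lt ij(3) det1 by simp
  qed
  have "lin_indpt (set (cols A\<^sup>T))"
  proof
    assume "lin_dep (set (cols A\<^sup>T))"
    then obtain v where v: "v \<in> carrier_vec k" "v \<noteq> 0\<^sub>v k" "A\<^sup>T *\<^sub>v v = 0\<^sub>v n"
      using lin_depE[OF AT _ dist] by blast
    have "?A1\<^sup>T *\<^sub>v v = 0\<^sub>v k"
    proof (rule eq_vecI)
      fix i assume i: "i < dim_vec (0\<^sub>v k :: complex vec)"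
      then have "(?A1\<^sup>T *\<^sub>v v) $ i = (A\<^sup>T *\<^sub>v v) $ i"
        using v(1) A kn by (auto simp: scalar_prod_def intro!: sum.cong)
      then show "(?A1\<^sup>T *\<^sub>v v) $ i = 0\<^sub>v k $ i" using v(3) i kn by simp
    qed simp
    then have "det (?A1\<^sup>T) = 0" using v(1,2) by (subst det_0_iff_vec_prod_zero[of _ k]) auto
    then show False using det1 det_transpose[of ?A1 k] by simp
  qed
  then have "rank (A\<^sup>T) = k" using lin_indpt_full_rank[OF AT dist] by simp
  then have "vectorspace.dim class_ring (span_vs (set (rows A))) = k"
    by (simp add: rank_def)
  moreover have "VectorSpace.subspace class_ring (span (set (rows A))) V"
    using A by (intro span_is_subspace) (auto simp: rows_def)
  ultimately show ?thesis unfolding Gr_def by simp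
qed

text \<open>Pluecker coordinates list columns in increasing order, whereas replacing a column in
  Cramer's rule gives an unsorted list, possibly with a repetition. A repetition makes both
  determinants vanish; otherwise the same permutation sorts both column lists.\<close>

lemma det_cols_of_plucker:
  assumes A: "A \<in> carrier_mat k n" "A' \<in> carrier_mat k n"
    and pl: "\<And>I. I \<subseteq> {0..<n} \<Longrightarrow> card I = k \<Longrightarrow> plucker A' I = c * plucker A I"
    and f: "\<And>j. j < k \<Longrightarrow> f j < n"
  shows "det (mat k k (\<lambda>(i, j). A' $$ (i, f j))) = c * det (mat k k (\<lambda>(i, j). A $$ (i, f j)))"
proof (cases "inj_on f {0..<k}")
  case False
  then obtain i j where ij: "i < k" "j < k" "i \<noteq> j" "f i = f j" by (auto simp: inj_on_def)
  have "det (mat k k (\<lambda>(i, j). B $$ (i, f j))) = 0" for B :: "complex mat"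
    using ij by (intro det_identical_cols[of _ k i j]) (auto intro!: eq_vecI)
  then show ?thesis by simp
next
  case True
  define I where "I = f ` {0..<k}"
  have I: "I \<subseteq> {0..<n}" "card I = k" using f True by (auto simp: I_def card_image)
  define p where "p j = (if j < k then card {a \<in> I. a < f j} else j)" for j
  have fp: "f j = pick I (p j)" if "j < k" for j
    using that pick_card_in_set[of "f j" I] by (simp add: p_def I_def)
  have pk: "p j < k" if "j < k" for j
  proof -
    have "{a \<in> I. a < f j} \<subset> I" using that by (auto simp: I_def)
    then show ?thesis using psubset_card_mono[of I] I that by (simp add: p_def I_def)
  qed
  have p: "p permutes {0..<k}"
  proof (rule inj_on_nat_permutes)
    show "inj_on p {0..<k}" using True fp by (auto simp: inj_on_def)
  qed (use pk in \<open>auto simp: p_def\<close>)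
  have "det (mat k k (\<lambda>(i, j). B $$ (i, f j))) = signof p * plucker B I" if "B \<in> carrier_mat k n" for B
  proof -
    have "mat k k (\<lambda>(i, j). B $$ (i, f j)) =
        mat k k (\<lambda>(i, j). mat k k (\<lambda>(i, j). B $$ (i, pick I j)) $$ (i, p j))"
      using fp pk by (intro eq_matI) auto
    then show ?thesis by (simp add: det_permute_cols[OF _ p] plucker_eq_det[OF that I])
  qed
  then show ?thesis using A pl[OF I] by simp
qed

text \<open>By Cramer's rule the entries of the reduced matrix \<open>A\<^sub>1\<inverse> A\<close>, where \<open>A\<^sub>1\<close> consists of
  the first \<open>k\<close> columns of \<open>A\<close>, are ratios of minors of \<open>A\<close>.\<close>

lemma row_span_eq_if_plucker_proportional:
  assumes A: "A \<in> carrier_mat k n" "A' \<in> carrier_mat k n" and kn: "k \<le> n"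
    and pl: "\<And>I. I \<subseteq> {0..<n} \<Longrightarrow> card I = k \<Longrightarrow> plucker A' I = c * plucker A I"
    and c: "c \<noteq> 0" and det: "plucker A {0..<k} \<noteq> 0"
  shows "row_span n A' = row_span n A"
proof -
  let ?L = "\<lambda>B. mat k k (\<lambda>(i, j). B $$ (i, j)) :: complex mat"
  let ?R = "\<lambda>B a j. mat k k (\<lambda>(i, b). B $$ (i, if b = a then j else b)) :: complex mat"
  have L: "det (?L B) = plucker B {0..<k}" if "B \<in> carrier_mat k n" for B
  proof -
    have "mat k k (\<lambda>(i, j). B $$ (i, pick {0..<k} j)) = ?L B"
      using pick_atLeastLessThan[of _ k 0] by (intro eq_matI) auto
    then show ?thesis using kn by (simp add: plucker_eq_det[OF that])
  qed
  have reduced: "\<exists>M\<in>carrier_mat k n. B = ?L B * M \<and>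
      (\<forall>a<k. \<forall>j<n. det (?R B a j) = M $$ (a, j) * det (?L B))"
    if B: "B \<in> carrier_mat k n" and d: "det (?L B) \<noteq> 0" for B
  proof -
    obtain C where C: "C \<in> carrier_mat k k" "?L B * C = 1\<^sub>m k"
      using det_nonzero_inverse[of "?L B" k] d by auto
    define M where "M = C * B"
    have M: "M \<in> carrier_mat k n" using C B by (simp add: M_def)
    have eq: "?L B * M = B"
      using C B by (simp add: M_def assoc_mult_mat[symmetric, of _ k k C k B n])
    have "det (?R B a j) = M $$ (a, j) * det (?L B)" if "a < k" "j < n" for a j
    proof -
      have "?L B *\<^sub>v col M j = col B j"
        using col_mult2[of "?L B" k k M n j] M that eq by simp
      then have "replace_col (?L B) (?L B *\<^sub>v col M j) a = ?R B a j"
        using B kn that by (intro eq_matI) (auto simp: replace_col_def)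
      then show ?thesis using cramer_lemma_mat[of "?L B" k "col M j" a] M that by simp
    qed
    then show ?thesis using M eq by (intro bexI[of _ M]) auto
  qed
  have LA: "det (?L A') = c * det (?L A)" unfolding L[OF A(1)] L[OF A(2)] using kn by (intro pl) auto
  have dA: "det (?L A) \<noteq> 0" "det (?L A') \<noteq> 0" using det c unfolding LA unfolding L[OF A(1)] by simp_all
  obtain M where M: "M \<in> carrier_mat k n" "A = ?L A * M"
    "\<And>a j. a < k \<Longrightarrow> j < n \<Longrightarrow> det (?R A a j) = M $$ (a, j) * det (?L A)"
    using reduced[OF A(1) dA(1)] by blast
  obtain M' where M': "M' \<in> carrier_mat k n" "A' = ?L A' * M'"
    "\<And>a j. a < k \<Longrightarrow> j < n \<Longrightarrow> det (?R A' a j) = M' $$ (a, j) * det (?L A')"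
    using reduced[OF A(2) dA(2)] by blast
  have "M' = M"
  proof (rule eq_matI)
    fix a j assume "a < dim_row M" "j < dim_col M"
    then have aj: "a < k" "j < n" using M by auto
    \<comment> \<open>Numerator and denominator in Cramer's rule both acquire the factor c, so the
      reduced matrices agree.\<close>
    have "det (?R A' a j) = c * det (?R A a j)"
      by (rule det_cols_of_plucker[OF A pl]) (use aj kn in auto)
    then show "M' $$ (a, j) = M $$ (a, j)" using M(3)[OF aj] M'(3)[OF aj] LA dA by simp
  qed (use M M' in auto)
  moreover have "row_span n A = row_span n M"
    using row_span_mult_invertible[of "?L A" k M n] dA M by (metis mat_carrier)
  moreover have "row_span n A' = row_span n M'"
    using row_span_mult_invertible[of "?L A'" k M' n] dA M' by (metis mat_carrier)
  ultimately show ?thesis by simp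
qed

text \<open>Any A whose rows, with alternating signs, annihilate the columns \<open>{k..<n}\<close>
  of g represents the value of \<open>gamma\<close> at g. The unit corner minor makes the leading
  minor of A the scalar in \<open>gamma_rel\<close>; that it is nonzero gives both the dimension and
  the uniqueness.\<close>

lemma gamma_rel_iff:
  assumes A: "A \<in> carrier_mat k n" and kn: "k \<le> n" and det: "plucker A {0..<k} \<noteq> 0"
    and g: "g \<in> carrier_mat n n" "det (submatrix g {k..<n} {k..<n}) = 1"
    and orth: "\<And>a s. a < k \<Longrightarrow> k \<le> s \<Longrightarrow> s < n \<Longrightarrow>
      (\<Sum>i<n. (-1) ^ i * A $$ (a, i) * g $$ (i, s)) = 0"
  shows "gamma_rel k n g V \<longleftrightarrow> V = row_span n A"
proof
  have pl: "plucker A I = plucker A {0..<k} * det (submatrix g ({0..<n} - I) {k..<n})"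
    if "I \<subseteq> {0..<n}" "card I = k" for I
    using plucker_complementary_minor[OF A g(1) orth that] g(2) by simp
  then show "V = row_span n A \<Longrightarrow> gamma_rel k n g V"
    using A det row_span_in_Gr[OF A kn det] unfolding gamma_rel_def by blast
  assume "gamma_rel k n g V"
  then obtain A' d where A': "A' \<in> carrier_mat k n" "row_span n A' = V" and d: "d \<noteq> 0"
    and pl': "\<And>I. I \<subseteq> {0..<n} \<Longrightarrow> card I = k \<Longrightarrow>
      plucker A' I = d * det (submatrix g ({0..<n} - I) {k..<n})"
    unfolding gamma_rel_def by blast
  have "row_span n A' = row_span n A"
  proof (rule row_span_eq_if_plucker_proportional[OF A A'(1) kn _ _ det])
    show "plucker A' I = (d / plucker A {0..<k}) * plucker A I"
      if "I \<subseteq> {0..<n}" "card I = k" for I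
      unfolding pl[OF that] pl'[OF that] using det by simp
  qed (use d det in simp)
  then show "V = row_span n A" using A' by simp
qed

section \<open>Vandermonde matrices and elementary symmetric polynomials\<close>

text \<open>For finite S this is the span of the vectors (1, x, ..., x^(n-1)) with x in S. Indexing
  by a set of nodes forgets the order of the points, which neither \<open>umat\<close> nor the span
  sees.\<close>

definition power_span :: "nat \<Rightarrow> complex set \<Rightarrow> complex vec set" where
  "power_span n S = {vec n (\<lambda>i. \<Sum>x\<in>S. a x * x ^ i) | a. True}"

lemma power_spanI: "vec n (\<lambda>i. \<Sum>x\<in>S. a x * x ^ i) \<in> power_span n S"
  by (auto simp: power_span_def)

text \<open>Pairing the relation with the coefficients of a polynomial that vanishes at every node
  except \<open>z l\<close> isolates \<open>a l\<close>; its degree is at most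
  \<open>card J - 1\<close>, so the n given equations suffice.\<close>

lemma vandermonde_independent:
  fixes z :: "'b \<Rightarrow> 'a :: field"
  assumes "finite J" "inj_on z J" "card J \<le> n"
    and zero: "\<And>i. i < n \<Longrightarrow> (\<Sum>j\<in>J. a j * z j ^ i) = 0"
    and l: "l \<in> J"
  shows "a l = 0"
proof -
  define p where "p = (\<Prod>j\<in>J - {l}. [:- z j, 1:])"
  have deg: "degree p < n"
  proof -
    have "degree p \<le> (\<Sum>j\<in>J - {l}. degree [:- z j, 1:])"
      unfolding p_def by (rule degree_prod_sum_le[unfolded o_def]) (use assms(1) in simp)
    also have "\<dots> = card J - 1" using l assms(1) by simp
    also have "\<dots> < n" using assms(1,3) l card_gt_0_iff[of J] by fastforce
    finally show ?thesis .
  qed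
  have root: "poly p (z j) = 0" if "j \<in> J" "j \<noteq> l" for j
    using that assms(1) by (auto simp: p_def poly_prod)
  have nz: "poly p (z l) \<noteq> 0"
    using l assms(1,2) by (auto simp: p_def poly_prod inj_on_def)
  have "a l * poly p (z l) = (\<Sum>j\<in>J. a j * poly p (z j))"
    using l assms(1) root by (subst sum.remove[of J l]) auto
  also have "\<dots> = (\<Sum>j\<in>J. \<Sum>i\<le>degree p. coeff p i * (a j * z j ^ i))"
    by (simp add: poly_altdef sum_distrib_left mult_ac)
  also have "\<dots> = (\<Sum>i\<le>degree p. coeff p i * (\<Sum>j\<in>J. a j * z j ^ i))"
    by (subst sum.swap) (simp add: sum_distrib_left)
  also have "\<dots> = 0" using zero deg by (intro sum.neutral) auto
  finally show ?thesis using nz by simp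
qed

text \<open>A new node y would satisfy a linear relation over \<open>insert y S\<close> with
  coefficient -1 at y, against the independence of at most n nodes.\<close>

lemma mem_power_span_imp_mem:
  assumes "vec n (\<lambda>i. y ^ i) \<in> power_span n S" "finite S" "card (insert y S) \<le> n"
  shows "y \<in> S"
proof (rule ccontr)
  assume y: "y \<notin> S"
  obtain a where a: "vec n (\<lambda>i. y ^ i) = vec n (\<lambda>i. \<Sum>x\<in>S. a x * x ^ i)"
    using assms(1) by (auto simp: power_span_def)
  let ?a = "\<lambda>x. if x = y then -1 else a x"
  have "(\<Sum>x\<in>insert y S. ?a x * id x ^ i) = 0" if "i < n" for i
  proof -
    have "y ^ i = (\<Sum>x\<in>S. a x * x ^ i)" using arg_cong[OF a, of "\<lambda>v. v $ i"] that by simp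
    moreover have "(\<Sum>x\<in>S. ?a x * id x ^ i) = (\<Sum>x\<in>S. a x * x ^ i)"
      using y by (intro sum.cong) auto
    ultimately show ?thesis using y assms(2) by simp
  qed
  then have "?a y = 0"
    by (rule vandermonde_independent[of "insert y S" id n ?a y, rotated 3])
      (use assms in simp_all)
  then show False by simp
qed

text \<open>Rows are numbered from 0 but the points from 1, whence \<open>Suc a\<close>.\<close>

definition vandermonde :: "nat \<Rightarrow> nat \<Rightarrow> (nat \<Rightarrow> complex) \<Rightarrow> complex mat" where
  "vandermonde k n z = mat k n (\<lambda>(a, i). z (Suc a) ^ i)"

lemma vandermonde_carrier [simp]: "vandermonde k n z \<in> carrier_mat k n"
  by (simp add: vandermonde_def)

text \<open>A kernel vector of the transposed leading block is a combination of k geometric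
  progressions with distinct ratios that vanishes at k positions, hence zero.\<close>

lemma plucker_vandermonde_nonzero:
  assumes inj: "inj_on z {1..k}" and kn: "k \<le> n"
  shows "plucker (vandermonde k n z) {0..<k} \<noteq> 0"
proof
  let ?V = "mat k k (\<lambda>(a, i). z (Suc a) ^ i)"
  assume "plucker (vandermonde k n z) {0..<k} = 0"
  moreover have "mat k k (\<lambda>(i, j). vandermonde k n z $$ (i, pick {0..<k} j)) = ?V"
    using pick_atLeastLessThan[of _ k 0] kn by (intro eq_matI) (auto simp: vandermonde_def)
  ultimately have "det (?V\<^sup>T) = 0"
    using kn det_transpose[of ?V k] by (simp add: plucker_eq_det[OF vandermonde_carrier])
  then obtain v where v: "v \<in> carrier_vec k" "v \<noteq> 0\<^sub>v k" "?V\<^sup>T *\<^sub>v v = 0\<^sub>v k"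
    using det_0_iff_vec_prod_zero[of "?V\<^sup>T" k] by auto
  have "inj_on (\<lambda>a. z (Suc a)) {..<k}"
    using comp_inj_on[of Suc "{..<k}" z] inj by (simp add: comp_def image_Suc_lessThan)
  moreover have "(\<Sum>a<k. v $ a * z (Suc a) ^ i) = 0" if "i < k" for i
  proof -
    have "(?V\<^sup>T *\<^sub>v v) $ i = (\<Sum>a<k. v $ a * z (Suc a) ^ i)"
      using that v(1) by (auto simp: scalar_prod_def atLeast0LessThan mult.commute intro!: sum.cong)
    then show ?thesis using v(3) that by simp
  qed
  ultimately have "v $ a = 0" if "a < k" for a
    using vandermonde_independent[of "{..<k}" "\<lambda>a. z (Suc a)" k "\<lambda>a. v $ a" a] that by simp
  then have "v = 0\<^sub>v k" using v(1) by (intro eq_vecI) auto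
  then show False using v(2) by simp
qed

lemma row_span_vandermonde:
  "row_span n (vandermonde k n z) = span_Cn n {vec n (\<lambda>i. z j ^ i) | j. j \<in> {1..k}}"
proof -
  have "set (rows (vandermonde k n z)) = (\<lambda>a. vec n (\<lambda>i. z (Suc a) ^ i)) ` {0..<k}"
    unfolding rows_def by (auto simp: vandermonde_def row_def intro!: image_cong eq_vecI)
  also have "\<dots> = (\<lambda>j. vec n (\<lambda>i. z j ^ i)) ` Suc ` {0..<k}"
    by (simp only: image_image)
  also have "Suc ` {0..<k} = {1..k}"
    by (simp add: image_Suc_atLeastLessThan atLeastLessThanSuc_atLeastAtMost)
  also have "(\<lambda>j. vec n (\<lambda>i. z j ^ i)) ` {1..k} = {vec n (\<lambda>i. z j ^ i) | j. j \<in> {1..k}}"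
    by (simp only: Setcompr_eq_image Collect_mem_eq)
  finally show ?thesis by simp
qed

lemma row_span_vandermonde_eq_power_span:
  assumes inj: "inj_on z {1..k}"
  shows "row_span n (vandermonde k n z) = power_span n (z ` {1..k})"
proof -
  have reindex: "(\<Sum>x\<in>z ` {1..k}. a x * x ^ i) = (\<Sum>j<k. a (z (Suc j)) * z (Suc j) ^ i)" for a i
  proof -
    have "(\<Sum>x\<in>z ` {1..k}. a x * x ^ i) = (\<Sum>j\<in>{1..k}. a (z j) * z j ^ i)"
      using inj by (simp add: sum.reindex)
    also have "\<dots> = (\<Sum>j<k. a (z (Suc j)) * z (Suc j) ^ i)"
      by (rule sum.reindex_bij_witness[of _ Suc "\<lambda>j. j - 1"]) auto
    finally show ?thesis .
  qed
  have rows: "(\<Sum>a<k. c a * vandermonde k n z $$ (a, i)) = (\<Sum>a<k. c a * z (Suc a) ^ i)"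
    if "i < n" for c i
    using that by (intro sum.cong) (auto simp: vandermonde_def)
  show ?thesis
    unfolding row_span_eq[OF vandermonde_carrier] power_span_def reindex
  proof (intro equalityI subsetI)
    fix v assume "v \<in> {vec n (\<lambda>i. \<Sum>a<k. c a * vandermonde k n z $$ (a, i)) | c. True}"
    then obtain c where "v = vec n (\<lambda>i. \<Sum>a<k. c a * vandermonde k n z $$ (a, i))" by auto
    then have v: "v = vec n (\<lambda>i. \<Sum>a<k. c a * z (Suc a) ^ i)"
      using rows by (auto intro!: eq_vecI)
    let ?a = "\<lambda>x. c (the_inv_into {1..k} z x - 1)"
    have "v = vec n (\<lambda>i. \<Sum>j<k. ?a (z (Suc j)) * z (Suc j) ^ i)"
      unfolding v using the_inv_into_f_f[OF inj] by (intro eq_vecI) (auto intro!: sum.cong)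
    then show "v \<in> {vec n (\<lambda>i. \<Sum>j<k. a (z (Suc j)) * z (Suc j) ^ i) | a. True}"
      by (intro CollectI exI[of _ ?a] conjI TrueI)
  next
    fix v assume "v \<in> {vec n (\<lambda>i. \<Sum>j<k. a (z (Suc j)) * z (Suc j) ^ i) | a. True}"
    then obtain a where v: "v = vec n (\<lambda>i. \<Sum>j<k. a (z (Suc j)) * z (Suc j) ^ i)" by auto
    have "v = vec n (\<lambda>i. \<Sum>j<k. a (z (Suc j)) * vandermonde k n z $$ (j, i))"
      unfolding v using rows by (intro eq_vecI) auto
    then show "v \<in> {vec n (\<lambda>i. \<Sum>a<k. c a * vandermonde k n z $$ (a, i)) | c. True}"
      by (intro CollectI exI[of _ "\<lambda>j. a (z (Suc j))"]) simp
  qed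
qed

lemma power_span_in_Gr:
  assumes "finite S" "card S \<le> n"
  shows "power_span n S \<in> Gr (card S) n"
proof -
  obtain z where z: "bij_betw z {1..card S} S" using ex_bij_betw_nat_finite_1[OF assms(1)] by auto
  then have inj: "inj_on z {1..card S}" and im: "z ` {1..card S} = S"
    by (auto simp: bij_betw_def)
  show ?thesis
    using row_span_in_Gr[OF vandermonde_carrier assms(2) plucker_vandermonde_nonzero[OF inj assms(2)]]
    unfolding row_span_vandermonde_eq_power_span[OF inj] im .
qed

text \<open>With n nodes the Vandermonde matrix is square and invertible, so its rows span as much
  as those of the identity. Taken at all roots of x^n = c, this says that the eigenvectors of the
  shift span the whole space.\<close>

lemma power_span_full:
  assumes "finite S" "card S = n"
  shows "power_span n S = carrier_vec n"
proof -
  obtain z where z: "bij_betw z {1..n} S" using ex_bij_betw_nat_finite_1[OF assms(1)] assms(2) by auto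
  then have inj: "inj_on z {1..n}" and im: "z ` {1..n} = S" by (auto simp: bij_betw_def)
  let ?V = "vandermonde n n z"
  have "mat n n (\<lambda>(i, j). ?V $$ (i, pick {0..<n} j)) = ?V"
    using pick_atLeastLessThan[of _ n 0] by (intro eq_matI) (auto simp: vandermonde_def)
  then have "det ?V \<noteq> 0"
    using plucker_vandermonde_nonzero[OF inj order_refl]
    by (simp add: plucker_eq_det[OF vandermonde_carrier])
  then have "row_span n ?V = row_span n (1\<^sub>m n)"
    using row_span_mult_invertible[of ?V n "1\<^sub>m n" n] right_mult_one_mat[OF vandermonde_carrier]
    by simp
  also have "\<dots> = carrier_vec n"
  proof -
    have "v \<in> row_span n (1\<^sub>m n)" if "v \<in> carrier_vec n" for v
    proof -
      have "(\<Sum>a<n. v $ a * 1\<^sub>m n $$ (a, i)) = v $ i" if "i < n" for i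
      proof -
        have "(\<Sum>a<n. v $ a * 1\<^sub>m n $$ (a, i)) = (\<Sum>a<n. if a = i then v $ a else 0)"
          using that by (intro sum.cong) auto
        then show ?thesis using that by simp
      qed
      then have "v = vec n (\<lambda>i. \<Sum>a<n. v $ a * 1\<^sub>m n $$ (a, i))"
        using that by (intro eq_vecI) auto
      then show ?thesis unfolding row_span_eq[OF one_carrier_mat] by blast
    qed
    moreover have "row_span n (1\<^sub>m n) \<subseteq> carrier_vec n"
      unfolding row_span_eq[OF one_carrier_mat] by auto
    ultimately show ?thesis by auto
  qed
  finally show ?thesis using row_span_vandermonde_eq_power_span[OF inj] im by simp
qed

section \<open>Elementary symmetric polynomials and the value of \<open>gamma\<close> on
  \<open>umat\<close>\<close>

lemma esym_eq_0: "k < m \<Longrightarrow> esym k z m = 0"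
proof -
  assume "k < m"
  then have "\<not> (S \<subseteq> {1..k} \<and> card S = m)" for S using card_mono[of "{1..k}" S] by auto
  then have "{S. S \<subseteq> {1..k} \<and> card S = m} = {}" by blast
  then show ?thesis unfolding esym_def by (simp only: sum.empty)
qed

text \<open>Expand the product over subsets and group them by size. At \<open>x = - z j\<close> the
  product vanishes, which yields the orthogonality of the columns of \<open>umat\<close>.\<close>

lemma prod_add_eq_esym: "(\<Prod>i\<in>{1..k}. z i + x) = (\<Sum>m\<le>k. esym k z m * x ^ (k - m))"
proof -
  have card: "card X \<le> k" if "X \<subseteq> {1..k}" for X using card_mono[OF _ that] by simp
  have "(\<Prod>i\<in>{1..k}. z i + x) = (\<Sum>X\<in>Pow {1..k}. (\<Prod>i\<in>X. z i) * x ^ (k - card X))"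
    unfolding prod_add[OF finite_atLeastAtMost]
    by (intro sum.cong) (auto simp: card_Diff_subset finite_subset[of _ "{1..k}"])
  also have "\<dots> = (\<Sum>m\<le>k. \<Sum>X | X \<in> Pow {1..k} \<and> card X = m. (\<Prod>i\<in>X. z i) * x ^ (k - card X))"
    using card by (intro sum.group[symmetric]) auto
  also have "\<dots> = (\<Sum>m\<le>k. esym k z m * x ^ (k - m))"
    by (intro sum.cong) (auto simp: esym_def sum_distrib_right)
  finally show ?thesis .
qed

text \<open>Column \<open>s \<ge> k\<close> of \<open>umat k n z\<close>, with alternating signs, lists the coefficients of the
  polynomial \<open>\<plusminus>x\<^bsup>s-k\<^esup>\<Prod>(x - z\<^sub>i)\<close>.\<close>

lemma umat_col_orthogonal:
  assumes j: "j \<in> {1..k}" and s: "k \<le> s" "s < n"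
  shows "(\<Sum>i<n. (-1) ^ i * z j ^ i * umat k n z $$ (i, s)) = 0"
proof -
  let ?x = "- z j"
  have "(\<Sum>i<n. (-1) ^ i * z j ^ i * umat k n z $$ (i, s)) =
      (\<Sum>i<n. if i \<le> s then ?x ^ i * esym k z (s - i) else 0)"
    using s by (intro sum.cong) (auto simp: umat_def power_minus[of "z j"])
  also have "\<dots> = (\<Sum>i\<in>{i. i < n \<and> i \<le> s}. ?x ^ i * esym k z (s - i))"
    by (simp add: sum.If_cases Int_def)
  \<comment> \<open>For \<open>i < s - k\<close> the index \<open>s - i\<close> exceeds k, so the
    symmetric polynomial is zero.\<close>
  also have "\<dots> = (\<Sum>i\<in>{s - k..s}. ?x ^ i * esym k z (s - i))"
    using s by (intro sum.mono_neutral_right) (auto intro!: esym_eq_0)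
  also have "\<dots> = (\<Sum>m\<le>k. ?x ^ (s - m) * esym k z m)"
    using s by (intro sum.reindex_bij_witness[of _ "\<lambda>m. s - m" "\<lambda>i. s - i"]) auto
  also have "\<dots> = (\<Sum>m\<le>k. ?x ^ (s - k) * (esym k z m * ?x ^ (k - m)))"
  proof (intro sum.cong refl)
    fix m assume "m \<in> {..k}"
    then have "s - m = (s - k) + (k - m)" using s by simp
    then show "?x ^ (s - m) * esym k z m = ?x ^ (s - k) * (esym k z m * ?x ^ (k - m))"
      by (simp only: power_add mult_ac)
  qed
  also have "\<dots> = ?x ^ (s - k) * (\<Prod>i\<in>{1..k}. z i + ?x)"
    by (simp only: prod_add_eq_esym sum_distrib_left)
  also have "(\<Prod>i\<in>{1..k}. z i + ?x) = 0" using j by (intro prod_zero) auto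
  finally show ?thesis by simp
qed

lemma det_unitriangular:
  assumes "\<And>i. i < m \<Longrightarrow> f (i, i) = 1" "\<And>i j. j < i \<Longrightarrow> i < m \<Longrightarrow> f (i, j) = 0"
  shows "det (mat m m f) = (1 :: 'a :: comm_ring_1)"
proof -
  have "det (mat m m f) = prod_list (diag_mat (mat m m f))"
    using assms(2) by (intro det_upper_triangular) auto
  also have "diag_mat (mat m m f) = map (\<lambda>_. 1) [0..<m]"
    using assms(1) by (auto simp: diag_mat_def)
  finally show ?thesis by (simp add: map_replicate_const prod_list_replicate)
qed

lemma esym_0 [simp]: "esym k z 0 = 1"
proof -
  have "{S. S \<subseteq> {1..k} \<and> card S = 0} = {{}}" by (auto dest: finite_subset)
  then show ?thesis unfolding esym_def by simp
qed

lemma umat_carrier [simp]: "umat k n z \<in> carrier_mat n n"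
  by (simp add: umat_def)

lemma umat_in_GL: "umat k n z \<in> GL n"
proof (rule det_nonzero_GL)
  show "det (umat k n z) \<noteq> 0" unfolding umat_def by (subst det_unitriangular) auto
qed simp

lemma det_corner_submatrix:
  assumes g: "g \<in> carrier_mat n n"
    and "\<And>i. i < n \<Longrightarrow> g $$ (i, i) = 1" "\<And>i j. j < i \<Longrightarrow> i < n \<Longrightarrow> g $$ (i, j) = 0"
  shows "det (submatrix g {k..<n} {k..<n}) = (1 :: complex)"
  using assms(2,3) pick_atLeastLessThan
  by (subst submatrix_eq_mat_pick[OF g]) (auto intro!: det_unitriangular)

lemma gamma_rel_umat:
  assumes inj: "inj_on z {1..k}" and kn: "k \<le> n"
  shows "gamma_rel k n (umat k n z) V \<longleftrightarrow> V = row_span n (vandermonde k n z)"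
proof (rule gamma_rel_iff[OF vandermonde_carrier kn plucker_vandermonde_nonzero[OF inj kn] umat_carrier])
  show "det (submatrix (umat k n z) {k..<n} {k..<n}) = 1"
    by (rule det_corner_submatrix) (auto simp: umat_def)
  fix a s assume as: "a < k" "k \<le> s" "s < n"
  have "(\<Sum>i<n. (-1) ^ i * vandermonde k n z $$ (a, i) * umat k n z $$ (i, s)) =
      (\<Sum>i<n. (-1) ^ i * z (Suc a) ^ i * umat k n z $$ (i, s))"
    using as by (intro sum.cong) (auto simp: vandermonde_def)
  then show "(\<Sum>i<n. (-1) ^ i * vandermonde k n z $$ (a, i) * umat k n z $$ (i, s)) = 0"
    using as umat_col_orthogonal[of "Suc a"] by simp
qed

lemma gamma_umat:
  assumes "inj_on z {1..k}" "k \<le> n"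
  shows "gamma k n (umat k n z) = power_span n (z ` {1..k})"
  unfolding gamma_def gamma_rel_umat[OF assms] row_span_vandermonde_eq_power_span[OF assms(1)]
  by simp

text \<open>For 0 < k < n no admissible z gives the identity, so \<open>gamma\<close> needs a
  representative of its own there: the first k unit vectors, orthogonal to the remaining unit
  columns.\<close>

lemma gamma_rel_one:
  assumes kn: "k \<le> n"
  shows "gamma_rel k n (1\<^sub>m n) V \<longleftrightarrow>
    V = row_span n (mat k n (\<lambda>(a, i). if a = i then 1 else 0))" (is "_ \<longleftrightarrow> V = row_span n ?A")
proof (rule gamma_rel_iff[OF _ kn _ one_carrier_mat])
  show A: "?A \<in> carrier_mat k n" by simp
  have "mat k k (\<lambda>(i, j). ?A $$ (i, pick {0..<k} j)) = 1\<^sub>m k"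
    using pick_atLeastLessThan[of _ k 0] kn by (intro eq_matI) auto
  then show "plucker ?A {0..<k} \<noteq> 0" using kn by (simp add: plucker_eq_det[OF A])
  show "det (submatrix (1\<^sub>m n :: complex mat) {k..<n} {k..<n}) = 1"
    by (rule det_corner_submatrix) auto
  fix a s assume "a < k" "k \<le> s" "s < n"
  then show "(\<Sum>i<n. (-1) ^ i * ?A $$ (a, i) * 1\<^sub>m n $$ (i, s)) = 0"
    by (intro sum.neutral) auto
qed

section \<open>Subspaces fixed by the twisted shift\<close>

lemma power_vec_mem_power_span:
  assumes "finite S" "y \<in> S"
  shows "vec n (\<lambda>i. y ^ i) \<in> power_span n S"
proof -
  have "(\<Sum>x\<in>S. (if x = y then 1 else 0) * x ^ i) = y ^ i" for i
  proof -
    have "(\<Sum>x\<in>S. (if x = y then 1 else 0) * x ^ i) = (\<Sum>x\<in>S. if x = y then x ^ i else 0)"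
      by (intro sum.cong) auto
    then show ?thesis using assms by simp
  qed
  then show ?thesis using power_spanI[where S = S and a = "\<lambda>x. if x = y then 1 else 0"] by simp
qed

lemma Gr_closed:
  assumes "V \<in> Gr k n"
  shows "V \<subseteq> carrier_vec n" "0\<^sub>v n \<in> V"
    and "\<And>v w. v \<in> V \<Longrightarrow> w \<in> V \<Longrightarrow> v + w \<in> V"
    and "\<And>c v. v \<in> V \<Longrightarrow> c \<cdot>\<^sub>v v \<in> V"
proof -
  interpret vec_space "TYPE(complex)" n .
  have "submodule class_ring V (Cn n)"
    using assms by (simp add: Gr_def VectorSpace.subspace_def)
  then show "V \<subseteq> carrier_vec n" "0\<^sub>v n \<in> V"
    "\<And>v w. v \<in> V \<Longrightarrow> w \<in> V \<Longrightarrow> v + w \<in> V" "\<And>c v. v \<in> V \<Longrightarrow> c \<cdot>\<^sub>v v \<in> V"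
    unfolding submodule_def by (auto simp: module_vec_simps)
qed

lemma power_span_subset:
  assumes V: "V \<in> Gr k n" and "finite S" "\<And>x. x \<in> S \<Longrightarrow> vec n (\<lambda>i. x ^ i) \<in> V"
  shows "vec n (\<lambda>i. \<Sum>x\<in>S. a x * x ^ i) \<in> V"
  using assms(2,3)
proof (induction S rule: finite_induct)
  case empty
  have "vec n (\<lambda>i. \<Sum>x\<in>{}. a x * x ^ i) = 0\<^sub>v n" by (intro eq_vecI) auto
  then show ?case using Gr_closed[OF V] by simp
next
  case (insert y S)
  have "vec n (\<lambda>i. \<Sum>x\<in>insert y S. a x * x ^ i) =
      a y \<cdot>\<^sub>v vec n (\<lambda>i. y ^ i) + vec n (\<lambda>i. \<Sum>x\<in>S. a x * x ^ i)"
    using insert.hyps by (intro eq_vecI) auto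
  then show ?case using Gr_closed[OF V] insert by simp
qed

section \<open>Eigenvectors of the twisted shift and its invariant subspaces\<close>

context
  fixes k n :: nat and t c :: complex
  assumes n: "1 \<le> n" and c: "c = (-1) powi (int k - 1) * t"
begin

text \<open>The vector (1, x, ..., x^(n-1)) has eigenvalue x: shifting multiplies every entry but
  the last by x, and in the last place x * x^(n-1) = c is the twist applied to the first entry
  1.\<close>

lemma sigma_power_sum:
  assumes "S \<subseteq> {x. x ^ n = c}"
  shows "sigma k n t (vec n (\<lambda>i. \<Sum>x\<in>S. a x * x ^ i)) = vec n (\<lambda>i. \<Sum>x\<in>S. (x * a x) * x ^ i)"
proof (rule eq_vecI)
  fix i assume "i < dim_vec (vec n (\<lambda>i. \<Sum>x\<in>S. (x * a x) * x ^ i))"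
  then have i: "i < n" by simp
  show "sigma k n t (vec n (\<lambda>i. \<Sum>x\<in>S. a x * x ^ i)) $ i = vec n (\<lambda>i. \<Sum>x\<in>S. (x * a x) * x ^ i) $ i"
  proof (cases "Suc i < n")
    case True
    then show ?thesis using i by (auto simp: sigma_def intro!: sum.cong)
  next
    case False
    then have "n = Suc i" using i by simp
    then have "x * x ^ i = c" if "x \<in> S" for x using assms that by auto
    then have "(\<Sum>x\<in>S. (x * a x) * x ^ i) = (\<Sum>x\<in>S. c * a x)"
      by (intro sum.cong) (simp_all add: algebra_simps)
    then show ?thesis using i False n by (simp add: sigma_def c sum_distrib_left)
  qed
qed (simp add: sigma_def)

text \<open>Surjectivity holds because \<open>c \<noteq> 0\<close> makes every eigenvalue x nonzero,
  so coefficients can be divided by x.\<close>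

lemma sigma_power_span:
  assumes S: "S \<subseteq> {x. x ^ n = c}" and c0: "c \<noteq> 0"
  shows "sigma k n t ` power_span n S = power_span n S"
proof (intro equalityI subsetI)
  fix v assume "v \<in> sigma k n t ` power_span n S"
  then show "v \<in> power_span n S"
    unfolding power_span_def using sigma_power_sum[OF S] by fastforce
next
  fix v assume "v \<in> power_span n S"
  then obtain a where v: "v = vec n (\<lambda>i. \<Sum>x\<in>S. a x * x ^ i)" by (auto simp: power_span_def)
  have nz: "x \<noteq> 0" if "x \<in> S" for x using S that c0 n by auto
  have "v = vec n (\<lambda>i. \<Sum>x\<in>S. (x * (a x / x)) * x ^ i)"
    unfolding v using nz by (intro eq_vecI) (auto intro!: sum.cong)
  also have "\<dots> = sigma k n t (vec n (\<lambda>i. \<Sum>x\<in>S. (a x / x) * x ^ i))"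
    by (rule sigma_power_sum[OF S, symmetric])
  finally show "v \<in> sigma k n t ` power_span n S" by (rule image_eqI) (rule power_spanI)
qed

text \<open>Applying \<open>sigma - y\<close> to an invariant combination of eigenvectors removes the
  eigenvector with eigenvalue \<open>y\<close>.\<close>

lemma invariant_eigenvectors_mem:
  assumes V: "V \<in> Gr k n" and inv: "\<And>v. v \<in> V \<Longrightarrow> sigma k n t v \<in> V"
    and "finite S" "S \<subseteq> {x. x ^ n = c}" "\<And>x. x \<in> S \<Longrightarrow> a x \<noteq> 0"
    and "vec n (\<lambda>i. \<Sum>x\<in>S. a x * x ^ i) \<in> V"
  shows "\<forall>x\<in>S. vec n (\<lambda>i. x ^ i) \<in> V"
  using assms(3-)
proof (induction S arbitrary: a rule: finite_induct)
  case (insert y S)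
  note cl = Gr_closed[OF V]
  let ?u = "vec n (\<lambda>i. \<Sum>x\<in>insert y S. a x * x ^ i)"
  \<comment> \<open>The other coefficients are multiplied by \<open>x - y\<close>, nonzero since y
    is not in S, so the induction hypothesis applies to them.\<close>
  have "sigma k n t ?u + (- y) \<cdot>\<^sub>v ?u \<in> V"
    using insert.prems(3) inv cl by blast
  also have "sigma k n t ?u + (- y) \<cdot>\<^sub>v ?u = vec n (\<lambda>i. \<Sum>x\<in>S. ((x - y) * a x) * x ^ i)"
    unfolding sigma_power_sum[OF insert.prems(1)]
    using insert.hyps
    by (intro eq_vecI) (auto simp: algebra_simps sum_distrib_left sum_negf sum_subtractf)
  finally have "\<forall>x\<in>S. vec n (\<lambda>i. x ^ i) \<in> V"
    using insert.hyps insert.prems by (intro insert.IH[of "\<lambda>x. (x - y) * a x"]) auto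
  moreover from this have "?u + (- 1) \<cdot>\<^sub>v vec n (\<lambda>i. \<Sum>x\<in>S. a x * x ^ i) \<in> V"
    using power_span_subset[OF V insert.hyps(1)] insert.prems(3) cl by blast
  then have "(1 / a y) \<cdot>\<^sub>v (?u + (- 1) \<cdot>\<^sub>v vec n (\<lambda>i. \<Sum>x\<in>S. a x * x ^ i)) \<in> V"
    using cl by blast
  moreover have "(1 / a y) \<cdot>\<^sub>v (?u + (- 1) \<cdot>\<^sub>v vec n (\<lambda>i. \<Sum>x\<in>S. a x * x ^ i)) = vec n (\<lambda>i. y ^ i)"
    using insert.hyps insert.prems(2)[of y] by (intro eq_vecI) auto
  ultimately show ?case by auto
qed simp

text \<open>V is recovered from the set T of roots whose eigenvectors it contains: expand an element
  of V in all n eigenvectors; those with nonzero coefficient lie in V, so the expansion runs over T.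
  Comparing dimensions gives \<open>card T = k\<close>.\<close>

lemma sigma_fixed_eq:
  assumes c0: "c \<noteq> 0"
  shows "sigma_fixed k n t = power_span n ` {S. S \<subseteq> {x. x ^ n = c} \<and> card S = k}"
proof -
  let ?Z = "{x::complex. x ^ n = c}"
  have cZ: "card ?Z = n" using card_nth_roots[OF c0] n by simp
  then have fZ: "finite ?Z" using n card_ge_0_finite by fastforce
  have in_Gr: "power_span n S \<in> Gr (card S) n" if "S \<subseteq> ?Z" for S
    using power_span_in_Gr[of S n] finite_subset[OF that fZ] card_mono[OF fZ that] cZ by simp
  show ?thesis
  proof (intro equalityI subsetI)
    fix V assume "V \<in> sigma_fixed k n t"
    then have V: "V \<in> Gr k n" and inv: "sigma k n t ` V = V" by (auto simp: sigma_fixed_def)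
    define T where "T = {x \<in> ?Z. vec n (\<lambda>i. x ^ i) \<in> V}"
    have T: "T \<subseteq> ?Z" by (auto simp: T_def)
    have fT: "finite T" using finite_subset[OF T fZ] .
    have "V = power_span n T"
    proof (intro equalityI subsetI)
      fix v assume v: "v \<in> V"
      then have "v \<in> power_span n ?Z"
        using power_span_full[OF fZ cZ] Gr_closed(1)[OF V] by auto
      then obtain a where va: "v = vec n (\<lambda>i. \<Sum>x\<in>?Z. a x * x ^ i)"
        by (auto simp: power_span_def)
      let ?S = "{x \<in> ?Z. a x \<noteq> 0}"
      have "v = vec n (\<lambda>i. \<Sum>x\<in>?S. a x * x ^ i)"
        unfolding va using fZ by (intro eq_vecI) (auto intro!: sum.mono_neutral_right)
      then have "\<forall>x\<in>?S. vec n (\<lambda>i. x ^ i) \<in> V"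
        using v fZ inv by (intro invariant_eigenvectors_mem[OF V, of ?S a]) auto
      then have ST: "?S \<subseteq> T" by (auto simp: T_def)
      have "v = vec n (\<lambda>i. \<Sum>x\<in>T. a x * x ^ i)"
        unfolding va using fZ T ST by (intro eq_vecI) (auto intro!: sum.mono_neutral_right)
      then show "v \<in> power_span n T" using power_spanI by simp
    next
      fix v assume "v \<in> power_span n T"
      then show "v \<in> V"
        unfolding power_span_def using power_span_subset[OF V fT] by (auto simp: T_def)
    qed
    moreover from this have "card T = k" using in_Gr[OF T] V by (simp add: Gr_def)
    ultimately show "V \<in> power_span n ` {S. S \<subseteq> ?Z \<and> card S = k}" using T by blast
  next
    fix V assume "V \<in> power_span n ` {S. S \<subseteq> ?Z \<and> card S = k}"
    then show "V \<in> sigma_fixed k n t"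
      using in_Gr sigma_power_span[OF _ c0] by (auto simp: sigma_fixed_def)
  qed
qed

text \<open>The kernel is trivial: entry \<open>Suc j\<close> of v reappears as entry j of the
  image, and entry 0 appears in the last place, multiplied by the nonzero c.\<close>

lemma sigma_matrix:
  assumes c0: "c \<noteq> 0"
  shows "\<exists>S\<in>GL n. \<forall>v\<in>carrier_vec n. sigma k n t v = S *\<^sub>v v"
proof -
  define S where "S = mat n n (\<lambda>(i, j). if Suc i < n then if j = Suc i then 1 else 0
    else if j = 0 then c else (0 :: complex))"
  have S: "S \<in> carrier_mat n n" by (simp add: S_def)
  have eq: "sigma k n t v = S *\<^sub>v v" if v: "v \<in> carrier_vec n" for v
  proof (rule eq_vecI)
    fix i assume "i < dim_vec (S *\<^sub>v v)"
    then have i: "i < n" using S by simp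
    have "(S *\<^sub>v v) $ i = (\<Sum>j<n. S $$ (i, j) * v $ j)"
      using i v S by (auto simp: scalar_prod_def atLeast0LessThan intro!: sum.cong)
    also have "\<dots> = (\<Sum>j<n. if j = (if Suc i < n then Suc i else 0)
        then (if Suc i < n then 1 else c) * v $ j else 0)"
      using i by (intro sum.cong) (auto simp: S_def)
    finally show "sigma k n t v $ i = (S *\<^sub>v v) $ i"
      using i n by (simp add: sigma_def c)
  qed (simp add: sigma_def S_def)
  have "det S \<noteq> 0"
  proof
    assume "det S = 0"
    then obtain v where v: "v \<in> carrier_vec n" "v \<noteq> 0\<^sub>v n" "S *\<^sub>v v = 0\<^sub>v n"
      using det_0_iff_vec_prod_zero[OF S] by auto
    have zero: "sigma k n t v $ i = 0" if "i < n" for i using eq[OF v(1)] v(3) that by simp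
    have "v $ i = 0" if "i < n" for i
    proof (cases i)
      case 0
      then show ?thesis using zero[of "n - 1"] n c c0 by (simp add: sigma_def)
    next
      case (Suc j)
      then show ?thesis using zero[of j] that by (simp add: sigma_def)
    qed
    then show False using v(1,2) by (auto intro!: eq_vecI)
  qed
  then show ?thesis using det_nonzero_GL[OF S] eq by blast
qed

end

text \<open>Taking images under z matches subsets of \<open>{1..k}\<close> with subsets of the set
  of points, so the sum can be written without the order of the points.\<close>

lemma esym_cong_image:
  assumes z: "inj_on z {1..k}" and z': "inj_on z' {1..k}" and im: "z ` {1..k} = z' ` {1..k}"
  shows "esym k z m = esym k z' m"
proof -
  have "esym k z m = (\<Sum>T | T \<subseteq> z ` {1..k} \<and> card T = m. \<Prod>T)" if z: "inj_on z {1..k}" for z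
    unfolding esym_def
  proof (rule sum.reindex_bij_witness[where i = "\<lambda>T. {i \<in> {1..k}. z i \<in> T}" and j = "\<lambda>S. z ` S"])
    fix S assume "S \<in> {S. S \<subseteq> {1..k} \<and> card S = m}"
    then have S: "S \<subseteq> {1..k}" "card S = m" by auto
    have zS: "inj_on z S" using inj_on_subset[OF z S(1)] .
    show "{i \<in> {1..k}. z i \<in> z ` S} = S" using S(1) inj_onD[OF z] by blast
    show "z ` S \<in> {T. T \<subseteq> z ` {1..k} \<and> card T = m}"
      using S card_image[OF zS] by blast
    show "\<Prod>(z ` S) = prod z S" using prod.reindex[OF zS, of "\<lambda>x. x"] by simp
  next
    fix T assume "T \<in> {T. T \<subseteq> z ` {1..k} \<and> card T = m}"
    then have T: "T \<subseteq> z ` {1..k}" "card T = m" by auto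
    show im: "z ` {i \<in> {1..k}. z i \<in> T} = T" using T(1) by blast
    have "card (z ` {i \<in> {1..k}. z i \<in> T}) = card {i \<in> {1..k}. z i \<in> T}"
      by (intro card_image inj_on_subset[OF z]) blast
    then show "{i \<in> {1..k}. z i \<in> T} \<in> {S. S \<subseteq> {1..k} \<and> card S = m}"
      unfolding im using T(2) by auto
  qed
  from this[OF z] this[OF z'] show ?thesis unfolding im by simp
qed

text \<open>All nodes come from the same n roots, so adjoining a node of S to \<open>S'\<close>
  still gives at most n nodes, and equal spans force each set into the other.\<close>

lemma power_span_inj_on_roots:
  assumes n: "1 \<le> n" and c0: "c \<noteq> 0"
  shows "inj_on (power_span n) (Pow {x. x ^ n = (c :: complex)})"
proof (rule inj_onI)
  let ?Z = "{x::complex. x ^ n = c}"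
  have cZ: "card ?Z = n" using card_nth_roots[OF c0] n by simp
  then have fZ: "finite ?Z" using n card_ge_0_finite by fastforce
  have sub: "S \<subseteq> S'" if "S \<in> Pow ?Z" "S' \<in> Pow ?Z" "power_span n S = power_span n S'" for S S'
  proof
    fix y assume y: "y \<in> S"
    show "y \<in> S'"
      using that y power_vec_mem_power_span[of S y n] card_mono[OF fZ, of "insert y S'"] cZ
        finite_subset[OF _ fZ, of S] finite_subset[OF _ fZ, of S']
      by (intro mem_power_span_imp_mem[of n y S']) auto
  qed
  fix S S' assume "S \<in> Pow ?Z" "S' \<in> Pow ?Z" "power_span n S = power_span n S'"
  then show "S = S'" using sub[of S S'] sub[of S' S] by auto
qed

section \<open>The fibers of \<open>q\<close>\<close>

lemma umat_cong_image:
  assumes "inj_on z {1..k}" "inj_on z' {1..k}" "z ` {1..k} = z' ` {1..k}"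
  shows "umat k n z = umat k n z'"
  unfolding umat_def esym_cong_image[OF assms] ..

text \<open>The entry in position (0, k), inside the matrix and off its diagonal for 0 < k < n, is
  the product of all the points.\<close>

lemma umat_neq_one:
  assumes "0 < k" "k < n" "admissible k n z"
  shows "umat k n z \<noteq> 1\<^sub>m n"
proof
  assume "umat k n z = 1\<^sub>m n"
  from arg_cong[OF this, of "\<lambda>g. g $$ (0, k)"] have "esym k z k = 0"
    using assms(1,2) by (simp add: umat_def)
  moreover have "esym k z k = (\<Prod>i\<in>{1..k}. z i)"
  proof -
    have "S = {1..k}" if "S \<subseteq> {1..k}" "card S = k" for S
      using card_subset_eq[of "{1..k}" S] that by simp
    then have "{S. S \<subseteq> {1..k} \<and> card S = k} = {{1..k}}" by auto
    then show ?thesis unfolding esym_def by (simp only: sum.insert sum.empty) simp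
  qed
  ultimately show False using assms(3) by (auto simp: admissible_def)
qed

text \<open>At the identity only the first clause applies. Elsewhere the value is read off through
  \<open>gamma\<close>: equal matrices have equal spans, so \<open>z 1\<close> is one of the points
  of \<open>z'\<close>. Testing this adjoins one node to k others, and \<open>k < n\<close> keeps
  the total within n.\<close>

lemma q_graph_unique:
  assumes k: "0 < k" "k < n" and w: "q_graph k n g w" "q_graph k n g w'"
  shows "w = w'"
proof -
  consider "g = 1\<^sub>m n" | "g \<noteq> 1\<^sub>m n" by blast
  then show ?thesis
  proof cases
    case 1
    then show ?thesis using w umat_neq_one[OF k] unfolding q_graph_def by metis
  next
    case 2
    then obtain z c z' c' where z: "admissible k n z" "g = umat k n z" "\<forall>j\<in>{1..k}. z j ^ n = c"
        "w = (-1) powi (int k - 1) * c"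
      and z': "admissible k n z'" "g = umat k n z'" "\<forall>j\<in>{1..k}. z' j ^ n = c'"
        "w' = (-1) powi (int k - 1) * c'"
      using w unfolding q_graph_def by blast
    have inj: "inj_on z {1..k}" "inj_on z' {1..k}" using z(1) z'(1) by (auto simp: admissible_def)
    have eq: "power_span n (z ` {1..k}) = power_span n (z' ` {1..k})"
      using gamma_umat[OF inj(1), of n] gamma_umat[OF inj(2), of n] z(2) z'(2) k(2) by simp
    have "z 1 \<in> z' ` {1..k}"
    proof (rule mem_power_span_imp_mem)
      show "vec n (\<lambda>i. z 1 ^ i) \<in> power_span n (z' ` {1..k})"
        unfolding eq[symmetric] using k by (intro power_vec_mem_power_span) auto
      have "card (insert (z 1) (z' ` {1..k})) \<le> Suc (card (z' ` {1..k}))"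
        by (rule card_insert_le_m1) simp_all
      also have "\<dots> \<le> n" using card_image[OF inj(2)] k by simp
      finally show "card (insert (z 1) (z' ` {1..k})) \<le> n" .
    qed simp
    then obtain j where "j \<in> {1..k}" "z 1 = z' j" by auto
    then have "c = c'" using z(3) z'(3) k(1) by force
    then show ?thesis using z(4) z'(4) by simp
  qed
qed

lemma q_eq:
  assumes "0 < k" "k < n" "q_graph k n g w"
  shows "q k n g = w"
  unfolding q_def using assms q_graph_unique[OF assms(1,2)] by (intro the_equality) auto

lemma q_graph_umat:
  assumes "0 < k" "admissible k n z"
  shows "q_graph k n (umat k n z) ((-1) powi (int k - 1) * z 1 ^ n)"
proof -
  have "1 \<in> {1..k}" using assms(1) by simp
  then have "\<forall>j\<in>{1..k}. z j ^ n = z 1 ^ n" using assms(2) unfolding admissible_def by blast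
  then show ?thesis using assms(2) unfolding q_graph_def by blast
qed

lemma fiber_eq:
  assumes t: "t \<noteq> 0"
  shows "{g \<in> Y k n. q_graph k n g t} =
    umat k n ` {z. admissible k n z \<and> (\<forall>j\<in>{1..k}. z j ^ n = (-1) powi (int k - 1) * t)}"
proof -
  let ?e = "(-1 :: complex) powi (int k - 1)"
  \<comment> \<open>The sign is its own inverse, also for k = 0 with exponent -1, so the second
    clause of \<open>q_graph\<close> says that the common value c is (-1)^(k-1) t;
    \<open>t \<noteq> 0\<close> excludes the first clause.\<close>
  have ee: "?e * (?e * c) = c" for c
  proof -
    have "?e * ?e = 1" by (simp add: power_int_mult_distrib[symmetric])
    then show ?thesis by (simp flip: mult.assoc)
  qed
  then have "t = ?e * c \<longleftrightarrow> c = ?e * t" for c by metis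
  then show ?thesis using t by (auto simp: q_graph_def Y_def)
qed

text \<open>Both sides correspond to the k-subsets of the roots of x^n = c, through the set of
  points z. In terms of \<open>q_graph\<close> the bijection includes k = 0 and k = n, where each
  side has a single element.\<close>

lemma bij_betw_gamma_fiber:
  assumes n: "1 \<le> n" and kn: "k \<le> n" and t: "t \<noteq> 0"
  shows "bij_betw (gamma k n) {g \<in> Y k n. q_graph k n g t} (sigma_fixed k n t)"
proof -
  define c where "c = (-1) powi (int k - 1) * t"
  have c0: "c \<noteq> 0" using t by (simp add: c_def)
  let ?A = "{z. admissible k n z \<and> (\<forall>j\<in>{1..k}. z j ^ n = c)}"
  let ?Z = "{x. x ^ n = c}"
  have inj: "inj_on z {1..k}" if "z \<in> ?A" for z using that by (auto simp: admissible_def)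
  have gam: "gamma k n (umat k n z) = power_span n (z ` {1..k})" if "z \<in> ?A" for z
    using gamma_umat[OF inj[OF that] kn] .
  have images: "(\<lambda>z. z ` {1..k}) ` ?A = {S. S \<subseteq> ?Z \<and> card S = k}"
  proof (intro equalityI subsetI)
    fix S assume "S \<in> (\<lambda>z. z ` {1..k}) ` ?A"
    then obtain z where z: "z \<in> ?A" "S = z ` {1..k}" by blast
    then show "S \<in> {S. S \<subseteq> ?Z \<and> card S = k}" using card_image[OF inj[OF z(1)]] by auto
  next
    fix S assume "S \<in> {S. S \<subseteq> ?Z \<and> card S = k}"
    then have S: "S \<subseteq> ?Z" "card S = k" by auto
    have "finite ?Z" using card_nth_roots[OF c0, of n] n card_ge_0_finite[of ?Z] by simp
    then have "finite S" using S(1) finite_subset by blast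
    then obtain z where z: "bij_betw z {1..k} S" using ex_bij_betw_nat_finite_1 S(2) by blast
    have zj: "z j ^ n = c" if "j \<in> {1..k}" for j
      using S(1) bij_betwE[OF z] that by blast
    then have "z j \<noteq> 0" if "j \<in> {1..k}" for j using that c0 n by (metis not_one_le_zero power_0_left)
    then have "z \<in> ?A" using z zj by (auto simp: admissible_def bij_betw_def)
    then show "S \<in> (\<lambda>z. z ` {1..k}) ` ?A" using z by (auto simp: bij_betw_def)
  qed
  have "inj_on (gamma k n) (umat k n ` ?A)"
  proof (rule inj_onI, elim imageE)
    fix g g' z z' assume z: "z \<in> ?A" "g = umat k n z" and z': "z' \<in> ?A" "g' = umat k n z'"
      and eq: "gamma k n g = gamma k n g'"
    have "z ` {1..k} = z' ` {1..k}"
    proof (rule inj_onD[OF power_span_inj_on_roots[OF n c0]])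
      show "power_span n (z ` {1..k}) = power_span n (z' ` {1..k})"
        using eq gam z z' by simp
    qed (use z z' in auto)
    then show "g = g'" using umat_cong_image inj z z' by simp
  qed
  moreover have "gamma k n ` umat k n ` ?A = sigma_fixed k n t"
  proof -
    have "gamma k n ` umat k n ` ?A = power_span n ` (\<lambda>z. z ` {1..k}) ` ?A"
      unfolding image_image using gam by (intro image_cong) auto
    then show ?thesis unfolding images sigma_fixed_eq[OF n c_def c0] .
  qed
  ultimately show ?thesis unfolding fiber_eq[OF t] c_def[symmetric] bij_betw_def by blast
qed

theorem theorem3p4:
  fixes n k :: nat
  assumes "1 \<le> n" and "k \<le> n"
  shows "(\<forall>z. umat k n z \<in> GL n)
    \<and> (0 < k \<and> k < n \<longrightarrow> q k n (1\<^sub>m n) = 0 \<and>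
        (\<forall>z. admissible k n z \<longrightarrow> q k n (umat k n z) = (-1) powi (int k - 1) * z 1 ^ n))
    \<and> (\<forall>g\<in>Y k n. \<exists>!V. gamma_rel k n g V)
    \<and> (\<forall>z. admissible k n z \<longrightarrow>
        gamma k n (umat k n z) = span_Cn n {vec n (\<lambda>i. z j ^ i) | j. j \<in> {1..k}})
    \<and> (\<forall>t. t \<noteq> 0 \<longrightarrow>
        (\<exists>S\<in>GL n. \<forall>v\<in>carrier_vec n. sigma k n t v = S *\<^sub>v v)
        \<and> (0 < k \<and> k < n \<longrightarrow> bij_betw (gamma k n) {g \<in> Y k n. q k n g = t} (sigma_fixed k n t))
        \<and> bij_betw (gamma k n) {g \<in> Y k n. q_graph k n g t} (sigma_fixed k n t))"
proof (intro conjI allI impI ballI)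
  fix z show "umat k n z \<in> GL n" by (rule umat_in_GL)
next
  assume "0 < k \<and> k < n"
  then show "q k n (1\<^sub>m n) = 0" by (intro q_eq) (auto simp: q_graph_def)
next
  fix z assume "0 < k \<and> k < n" "admissible k n z"
  then show "q k n (umat k n z) = (-1) powi (int k - 1) * z 1 ^ n"
    by (intro q_eq q_graph_umat) auto
next
  fix g assume "g \<in> Y k n"
  then consider "g = 1\<^sub>m n" | z where "admissible k n z" "g = umat k n z" by (auto simp: Y_def)
  then show "\<exists>!V. gamma_rel k n g V"
    by cases (simp_all add: gamma_rel_one gamma_rel_umat assms(2) admissible_def)
next
  fix z assume "admissible k n z"
  then have inj: "inj_on z {1..k}" by (simp add: admissible_def)
  show "gamma k n (umat k n z) = span_Cn n {vec n (\<lambda>i. z j ^ i) | j. j \<in> {1..k}}"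
    unfolding gamma_umat[OF inj assms(2)] row_span_vandermonde_eq_power_span[OF inj, symmetric]
    by (rule row_span_vandermonde)
next
  fix t :: complex assume t: "t \<noteq> 0"
  show "\<exists>S\<in>GL n. \<forall>v\<in>carrier_vec n. sigma k n t v = S *\<^sub>v v"
    by (rule sigma_matrix[OF assms(1) refl]) (use t in simp)
  show bij: "bij_betw (gamma k n) {g \<in> Y k n. q_graph k n g t} (sigma_fixed k n t)"
    by (rule bij_betw_gamma_fiber[OF assms t])
  assume k: "0 < k \<and> k < n"
  \<comment> \<open>For 0 < k < n the relation has exactly one value at each matrix of
    \<open>Y k n\<close>, so its fibers are those of the function \<open>q\<close>.\<close>
  have "q k n g = t \<longleftrightarrow> q_graph k n g t" if "g \<in> Y k n" for g
  proof -
    have "\<exists>w. q_graph k n g w"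
      using that k q_graph_umat[of k n] by (auto simp: Y_def q_graph_def[of k n "1\<^sub>m n"])
    then show ?thesis using q_eq k by metis
  qed
  then have "{g \<in> Y k n. q k n g = t} = {g \<in> Y k n. q_graph k n g t}" by blast
  then show "bij_betw (gamma k n) {g \<in> Y k n. q k n g = t} (sigma_fixed k n t)" using bij by simp
qed

end
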